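(* Let $-1<\rho<1$. Let $X_0,\xi_1,\xi_2,\dots$ be i.i.d. standard normal random variables, and let $X_n:=\rho X_{n-1}+\xi_n$ for $n\ge 1$. Let $\gamma$ be the standard Gaussian measure and let $M_\rho\colon L^2([0,\infty),\gamma)\to L^2([0,\infty),\gamma)$ be the integral operator $$M_\rho f(x)=\int_0^\infty f(y)\,m_\rho(x,y)\,\mathrm{d}\gamma(y),\qquad m_\rho(x,y)=\frac{1}{\sqrt{1-\rho^2}}\exp\left(-\frac{\rho^2x^2+\rho^2y^2-2\rho xy}{2(1-\rho^2)}\right).$$ Let $\lambda_\rho$ be the largest eigenvalue of $M_\rho$. Then $\lambda_\rho\in(0,1)$, and there exist constants $c_\rho,C_\rho>0$ (depending on $\rho$ but not on $N$) such that for all $N\in\mathbb{N}$ $$c_\rho\lambda_\rho^N\le \mathbb{P}(X_0\ge 0,\dots,X_N\ge 0)\le C_\rho\lambda_\rho^N.$$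
   Context: $\gamma$ denotes the standard Gaussian measure on $\mathbb{R}$, $\mathrm{d}\gamma(x)=\frac{1}{\sqrt{2\pi}}e^{-x^2/2}\,\mathrm{d}x$, and $L^2([0,\infty),\gamma)$ is taken with respect to its restriction to $[0,\infty)$. The operator $M_\rho$ is a well-defined, self-adjoint, compact (Hilbert-Schmidt) operator, so its largest eigenvalue makes sense. *)

theory Defs
  imports "HOL-Probability.Probability"
begin

definition std_gaussian :: "real measure" where
  "std_gaussian = density lborel (\<lambda>x. ennreal (std_normal_density x))"

definition halfline_gaussian :: "real measure" where
  "halfline_gaussian = restrict_space std_gaussian {0..}"

text \<open>
  Elements of \<open>L\<^sup>2(M)\<close> are represented by functions; equality in \<open>L\<^sup>2(M)\<close> is equality
  almost everywhere.
\<close>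

definition L2_functions :: "'a measure \<Rightarrow> ('a \<Rightarrow> real) set" where
  "L2_functions M = {f \<in> borel_measurable M. integrable M (\<lambda>x. (f x)\<^sup>2)}"

definition L2_eigenvalue :: "'a measure \<Rightarrow> (('a \<Rightarrow> real) \<Rightarrow> 'a \<Rightarrow> real) \<Rightarrow> real \<Rightarrow> bool" where
  "L2_eigenvalue M T l \<longleftrightarrow>
     (\<exists>f \<in> L2_functions M. \<not> (AE x in M. f x = 0) \<and> (AE x in M. T f x = l * f x))"

definition L2_largest_eigenvalue ::
    "'a measure \<Rightarrow> (('a \<Rightarrow> real) \<Rightarrow> 'a \<Rightarrow> real) \<Rightarrow> real \<Rightarrow> bool" where
  "L2_largest_eigenvalue M T l \<longleftrightarrow>
     L2_eigenvalue M T l \<and> (\<forall>l'. L2_eigenvalue M T l' \<longrightarrow> l' \<le> l)"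

definition ar_kernel :: "real \<Rightarrow> real \<Rightarrow> real \<Rightarrow> real" where
  "ar_kernel \<rho> x y =
     1 / sqrt (1 - \<rho>\<^sup>2) * exp (- ((\<rho>\<^sup>2 * x\<^sup>2 + \<rho>\<^sup>2 * y\<^sup>2 - 2 * \<rho> * x * y) / (2 * (1 - \<rho>\<^sup>2))))"

definition ar_operator :: "real \<Rightarrow> (real \<Rightarrow> real) \<Rightarrow> real \<Rightarrow> real" where
  "ar_operator \<rho> f x = (\<integral>y. f y * ar_kernel \<rho> x y \<partial>halfline_gaussian)"

end

theory Submission
  imports Defs
begin

text \<open>
  After rescaling by \<open>sqrt (1 - \<rho>\<^sup>2)\<close>, the chain has the transition density \<open>m\<^sub>\<rho>\<close> relative to \<open>\<gamma>\<close>
  and \<open>X 0\<close> is distributed like one step from \<open>0\<close>, so the persistence probability is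
  \<open>(M\<^sub>\<rho>\<^bsup>N+1\<^esup> 1) 0\<close>.

  For a symmetric positive Hilbert-Schmidt operator \<open>T\<close>, put \<open>u n = T\<^bsup>n\<^esup> 1\<close>. By Cauchy-Schwarz the ratios of
  successive norms \<open>\<parallel>u n\<parallel>\<close> increase to some \<open>\<lambda>\<close>, which gives \<open>\<parallel>u n\<parallel> \<le> \<parallel>u 0\<parallel> \<lambda>\<^bsup>n\<^esup>\<close>. The integral of \<open>u n\<close> is
  comparable to \<open>\<parallel>u n\<parallel>\<close>, so inner products of the \<open>u n\<close> are essentially submultiplicative and
  \<open>\<parallel>u n\<parallel> \<ge> c \<lambda>\<^bsup>n\<^esup>\<close>. The inner product of \<open>u (2 i) / \<lambda>\<^bsup>2 i\<^esup>\<close> and \<open>u (2 j) / \<lambda>\<^bsup>2 j\<^esup>\<close> depends on \<open>i + j\<close> only and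
  converges to a positive limit, hence these functions form a Cauchy sequence in \<open>L\<^sup>2\<close>, and one more
  application of \<open>T\<close> turns this into pointwise convergence. The limits yield both the two-sided bound
  on \<open>u n x\<close> and a strictly positive eigenfunction; pairing with the latter shows that no eigenvalue
  exceeds \<open>\<lambda>\<close>, and \<open>\<lambda> < 1\<close> because \<open>T 1 < 1\<close>.
\<close>

section \<open>Square integrable functions\<close>

definition L2_norm :: "'a measure \<Rightarrow> ('a \<Rightarrow> real) \<Rightarrow> real" where
  "L2_norm M f = sqrt (\<integral>x. (f x)\<^sup>2 \<partial>M)"

lemma L2_functionsD:
  assumes "f \<in> L2_functions M"
  shows "f \<in> borel_measurable M" "integrable M (\<lambda>x. (f x)\<^sup>2)"
  using assms by (auto simp: L2_functions_def)

lemma L2_norm_nonneg [simp]: "0 \<le> L2_norm M f"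
  by (simp add: L2_norm_def)

lemma L2_norm_power2: "(L2_norm M f)\<^sup>2 = (\<integral>x. (f x)\<^sup>2 \<partial>M)"
  by (simp add: L2_norm_def)

lemma L2_mult_integrable:
  assumes "f \<in> L2_functions M" "g \<in> L2_functions M"
  shows "integrable M (\<lambda>x. f x * g x)"
proof (rule Bochner_Integration.integrable_bound)
  show "integrable M (\<lambda>x. (f x)\<^sup>2 + (g x)\<^sup>2)"
    using assms by (auto dest: L2_functionsD)
  show "(\<lambda>x. f x * g x) \<in> borel_measurable M"
    using assms by (auto dest!: L2_functionsD(1))
  have "\<bar>a * b\<bar> \<le> a\<^sup>2 + b\<^sup>2" for a b :: real
    using sum_squares_bound[of "\<bar>a\<bar>" "\<bar>b\<bar>"] abs_ge_zero[of "a * b"]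
    unfolding abs_mult power2_abs mult.assoc by linarith
  then show "AE x in M. norm (f x * g x) \<le> norm ((f x)\<^sup>2 + (g x)\<^sup>2)"
    by (intro AE_I2) simp
qed

lemma L2_add:
  assumes "f \<in> L2_functions M" "g \<in> L2_functions M"
  shows "(\<lambda>x. f x + g x) \<in> L2_functions M"
  using assms L2_mult_integrable[OF assms]
  by (auto simp: L2_functions_def power2_sum mult.assoc)

lemma L2_cmult:
  assumes "f \<in> L2_functions M"
  shows "(\<lambda>x. c * f x) \<in> L2_functions M"
  using assms by (auto simp: L2_functions_def power_mult_distrib)

lemma L2_diff:
  assumes "f \<in> L2_functions M" "g \<in> L2_functions M"
  shows "(\<lambda>x. f x - g x) \<in> L2_functions M"
  using L2_add[OF assms(1) L2_cmult[OF assms(2), of "-1"]] by simp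

lemma L2_abs:
  assumes "f \<in> L2_functions M"
  shows "(\<lambda>x. \<bar>f x\<bar>) \<in> L2_functions M"
  using assms by (auto simp: L2_functions_def)

lemma L2_dominated:
  assumes "g \<in> L2_functions M" "f \<in> borel_measurable M"
    and "\<And>x. x \<in> space M \<Longrightarrow> \<bar>f x\<bar> \<le> g x"
  shows "f \<in> L2_functions M"
proof -
  have "integrable M (\<lambda>x. (f x)\<^sup>2)"
  proof (rule Bochner_Integration.integrable_bound)
    show "integrable M (\<lambda>x. (g x)\<^sup>2)" using assms(1) by (rule L2_functionsD)
    show "AE x in M. norm ((f x)\<^sup>2) \<le> norm ((g x)\<^sup>2)"
      using power_mono[OF assms(3), of _ 2] by (intro AE_I2) simp
  qed (use assms in measurable)
  then show ?thesis using assms by (simp add: L2_functions_def)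
qed

text \<open>The squared norm of \<open>f + t * g\<close> is a quadratic polynomial in
  \<open>t\<close> that never becomes negative; evaluating it at one suitable \<open>t\<close>
  bounds the middle coefficient.\<close>

lemma L2_Cauchy_Schwarz:
  assumes f: "f \<in> L2_functions M" and g: "g \<in> L2_functions M"
  shows "\<bar>\<integral>x. f x * g x \<partial>M\<bar> \<le> L2_norm M f * L2_norm M g"
proof -
  define F P G where "F = (\<integral>x. (f x)\<^sup>2 \<partial>M)" and "P = (\<integral>x. f x * g x \<partial>M)"
    and "G = (\<integral>x. (g x)\<^sup>2 \<partial>M)"
  note int = L2_mult_integrable[OF f g] L2_functionsD(2)[OF f] L2_functionsD(2)[OF g]
  have quadratic: "0 \<le> F + 2 * t * P + t\<^sup>2 * G" for t
  proof -
    have "0 \<le> (\<integral>x. (f x + t * g x)\<^sup>2 \<partial>M)" by simp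
    also have "\<dots> = (\<integral>x. (f x)\<^sup>2 + 2 * t * (f x * g x) + t\<^sup>2 * (g x)\<^sup>2 \<partial>M)"
      by (intro Bochner_Integration.integral_cong) (auto simp: power2_sum algebra_simps power_mult_distrib)
    also have "\<dots> = F + 2 * t * P + t\<^sup>2 * G"
      using int by (simp add: F_def P_def G_def)
    finally show ?thesis .
  qed
  have "G \<ge> 0" by (simp add: G_def)
  have "P\<^sup>2 \<le> F * G"
  proof (cases "G = 0")
    case True
    have "P = 0"
    proof (rule ccontr)
      assume "P \<noteq> 0"
      \<comment> \<open>With \<open>G = 0\<close> the polynomial is affine in \<open>t\<close>, and
        this \<open>t\<close> gives it the value -1.\<close>
      then show False using quadratic[of "- (F + 1) / (2 * P)"] True by (simp add: field_simps)
    qed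
    then show ?thesis using True by simp
  next
    case False
    then have "G > 0" using \<open>G \<ge> 0\<close> by simp
    \<comment> \<open>\<open>- P / G\<close> is the minimiser of the polynomial.\<close>
    then have "0 \<le> (F + 2 * (- P / G) * P + (- P / G)\<^sup>2 * G) * G"
      using quadratic[of "- P / G"] by (intro mult_nonneg_nonneg) auto
    also have "\<dots> = F * G - P\<^sup>2"
      using \<open>G > 0\<close> by (simp add: field_simps power2_eq_square)
    finally show ?thesis by simp
  qed
  then have "sqrt (P\<^sup>2) \<le> sqrt (F * G)" by (rule real_sqrt_le_mono)
  then show ?thesis by (simp add: F_def P_def G_def L2_norm_def real_sqrt_mult)
qed

context finite_measure
begin

lemma L2_const: "(\<lambda>_. c) \<in> L2_functions M"
  by (simp add: L2_functions_def)

lemma L2_integrable: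
  assumes "f \<in> L2_functions M"
  shows "integrable M f"
  using L2_mult_integrable[OF assms L2_const[of 1]] by simp

end

section \<open>Positive symmetric Hilbert-Schmidt kernels\<close>

text \<open>The bound \<open>B\<close> makes every row \<open>k x\<close> bounded, hence square
  integrable for each point \<open>x\<close> and not merely for almost every one. So
  \<open>T f x\<close> makes sense pointwise, which is what allows evaluation at the single point 0
  in the end.\<close>

locale positive_kernel = finite_measure M for M :: "'a measure" +
  fixes k :: "'a \<Rightarrow> 'a \<Rightarrow> real" and B :: "'a \<Rightarrow> real"
  assumes M_nonzero: "emeasure M (space M) \<noteq> 0"
    and k_measurable [measurable]: "case_prod k \<in> borel_measurable (M \<Otimes>\<^sub>M M)"
    and B_measurable [measurable]: "B \<in> borel_measurable M"
    and k_sym: "k x y = k y x"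
    and k_pos: "0 < k x y"
    and k_le: "x \<in> space M \<Longrightarrow> y \<in> space M \<Longrightarrow> k x y \<le> B x"
    and k_square_integrable: "integrable M (\<lambda>x. \<integral>y. (k x y)\<^sup>2 \<partial>M)"
begin

section \<open>The integral operator: boundedness, positivity, symmetry\<close>

definition T :: "('a \<Rightarrow> real) \<Rightarrow> 'a \<Rightarrow> real" where
  "T f x = (\<integral>y. f y * k x y \<partial>M)"

text \<open>\<open>K\<close> is a pointwise majorant for images under \<open>T\<close> of the unit
  ball, and its own norm is the Hilbert-Schmidt norm of \<open>k\<close>.\<close>

definition K :: "'a \<Rightarrow> real" where
  "K x = L2_norm M (k x)"

lemma K_L2: "K \<in> L2_functions M"
proof -
  have "K \<in> borel_measurable M" unfolding K_def L2_norm_def by measurable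
  then show ?thesis
    using k_square_integrable by (simp add: L2_functions_def K_def L2_norm_def)
qed

lemma K_nonneg: "0 \<le> K x"
  by (simp add: K_def)

lemma k_L2:
  assumes "x \<in> space M"
  shows "k x \<in> L2_functions M"
proof (rule L2_dominated[OF L2_const[of "B x"]])
  show "k x \<in> borel_measurable M" using assms by measurable
qed (use k_le k_pos assms in \<open>auto simp: abs_of_pos\<close>)

lemma T_integrable:
  assumes "f \<in> L2_functions M" "x \<in> space M"
  shows "integrable M (\<lambda>y. f y * k x y)"
  using assms by (intro L2_mult_integrable k_L2)

lemma T_measurable [measurable]:
  assumes [measurable]: "f \<in> borel_measurable M"
  shows "T f \<in> borel_measurable M"
  unfolding T_def by measurable

lemma T_bound:
  assumes "f \<in> L2_functions M" "x \<in> space M"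
  shows "\<bar>T f x\<bar> \<le> K x * L2_norm M f"
  using L2_Cauchy_Schwarz[OF assms(1) k_L2[OF assms(2)]] by (simp add: T_def K_def mult.commute)

lemma T_L2:
  assumes f: "f \<in> L2_functions M"
  shows "T f \<in> L2_functions M"
proof (rule L2_dominated)
  show "(\<lambda>x. L2_norm M f * K x) \<in> L2_functions M" by (intro L2_cmult K_L2)
  show "T f \<in> borel_measurable M" using L2_functionsD(1)[OF f] by measurable
  show "\<bar>T f x\<bar> \<le> L2_norm M f * K x" if "x \<in> space M" for x
    using T_bound[OF f that] by (simp add: mult.commute)
qed

lemma T_norm_bound:
  assumes f: "f \<in> L2_functions M"
  shows "L2_norm M (T f) \<le> L2_norm M K * L2_norm M f"
proof -
  have "(\<integral>x. (T f x)\<^sup>2 \<partial>M) \<le> (\<integral>x. (L2_norm M f)\<^sup>2 * (K x)\<^sup>2 \<partial>M)"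
  proof (rule integral_mono)
    show "integrable M (\<lambda>x. (L2_norm M f)\<^sup>2 * (K x)\<^sup>2)"
      using L2_functionsD(2)[OF K_L2] by simp
    show "(T f x)\<^sup>2 \<le> (L2_norm M f)\<^sup>2 * (K x)\<^sup>2" if "x \<in> space M" for x
      using power_mono[OF T_bound[OF f that], of 2] by (simp add: power_mult_distrib mult.commute)
  qed (use T_L2[OF f] in \<open>rule L2_functionsD\<close>)
  also have "\<dots> = (L2_norm M K * L2_norm M f)\<^sup>2"
    by (simp add: power_mult_distrib L2_norm_power2 mult.commute)
  finally show ?thesis
    unfolding L2_norm_power2[symmetric] by (rule power2_le_imp_le) simp
qed

lemma T_add:
  assumes "f \<in> L2_functions M" "g \<in> L2_functions M" "x \<in> space M"
  shows "T (\<lambda>x. f x + g x) x = T f x + T g x"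
  using T_integrable[OF assms(1,3)] T_integrable[OF assms(2,3)] by (simp add: T_def algebra_simps)

lemma T_cmult: "T (\<lambda>x. c * f x) x = c * T f x"
  by (simp add: T_def mult.assoc)

lemma T_diff:
  assumes "f \<in> L2_functions M" "g \<in> L2_functions M" "x \<in> space M"
  shows "T (\<lambda>x. f x - g x) x = T f x - T g x"
  using T_integrable[OF assms(1,3)] T_integrable[OF assms(2,3)] by (simp add: T_def algebra_simps)

text \<open>A nonnegative integrand with integral 0 vanishes almost everywhere; as \<open>k\<close>
  has no zeros, \<open>f\<close> would then vanish too.\<close>

lemma T_pos:
  assumes f: "f \<in> L2_functions M" "\<And>y. y \<in> space M \<Longrightarrow> 0 \<le> f y"
    and nz: "\<not> (AE y in M. f y = 0)" and x: "x \<in> space M"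
  shows "0 < T f x"
proof -
  have nn: "0 \<le> f y * k x y" if "y \<in> space M" for y
    using f(2)[OF that] k_pos[of x y] by simp
  have "T f x \<noteq> 0"
  proof
    assume "T f x = 0"
    then have "AE y in M. f y * k x y = 0"
      unfolding T_def using nn by (subst (asm) integral_nonneg_eq_0_iff_AE[OF T_integrable[OF f(1) x]]) auto
    moreover have "k x y \<noteq> 0" for y using k_pos[of x y] by simp
    ultimately show False using nz by simp
  qed
  moreover have "0 \<le> T f x"
    unfolding T_def using nn by (intro integral_nonneg_AE AE_I2)
  ultimately show ?thesis by simp
qed

lemma not_AE_zero_of_pos:
  assumes "\<And>x. x \<in> space M \<Longrightarrow> 0 < (f x :: real)"
  shows "\<not> (AE x in M. f x = 0)"
proof
  assume "AE x in M. f x = 0"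
  then have "AE x in M. False"
    by (rule AE_mp) (use assms in \<open>force intro!: AE_I2\<close>)
  then show False using M_nonzero by (simp add: AE_iff_measurable[OF _ refl])
qed

text \<open>Fubini together with \<open>k_sym\<close>. Absolute integrability of the double
  integrand holds because \<open>T\<close> maps the absolute value of \<open>f\<close> into L2,
  where it can be paired with the absolute value of \<open>g\<close>.\<close>

lemma T_symmetric:
  assumes f: "f \<in> L2_functions M" and g: "g \<in> L2_functions M"
  shows "(\<integral>x. T f x * g x \<partial>M) = (\<integral>x. f x * T g x \<partial>M)"
proof -
  interpret pair_sigma_finite M M ..
  note [measurable] = L2_functionsD(1)[OF f] L2_functionsD(1)[OF g]
  have "integrable (M \<Otimes>\<^sub>M M) (\<lambda>(x, y). f y * k x y * g x)"
  proof (rule Fubini_integrable)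
    show "(\<lambda>(x, y). f y * k x y * g x) \<in> borel_measurable (M \<Otimes>\<^sub>M M)"
      by measurable
    have "(\<integral>y. norm (case (x, y) of (x, y) \<Rightarrow> f y * k x y * g x) \<partial>M) = T (\<lambda>y. \<bar>f y\<bar>) x * \<bar>g x\<bar>" for x
      using k_pos[of x] by (simp add: T_def abs_mult abs_of_pos)
    then show "integrable M (\<lambda>x. \<integral>y. norm (case (x, y) of (x, y) \<Rightarrow> f y * k x y * g x) \<partial>M)"
      using L2_mult_integrable[OF T_L2[OF L2_abs[OF f]] L2_abs[OF g]] by simp
    show "AE x in M. integrable M (\<lambda>y. case (x, y) of (x, y) \<Rightarrow> f y * k x y * g x)"
      using T_integrable[OF f] by (intro AE_I2) simp
  qed
  from Fubini_integral[OF this]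
  have "(\<integral>y. (\<integral>x. f y * k x y * g x \<partial>M) \<partial>M) = (\<integral>x. (\<integral>y. f y * k x y * g x \<partial>M) \<partial>M)" .
  moreover have "(\<integral>x. f y * k x y * g x \<partial>M) = f y * T g y" for y
    using k_sym[of _ y] by (simp add: T_def mult.assoc mult.commute[of "k _ _"])
  ultimately show ?thesis by (simp add: T_def)
qed

section \<open>Iterates of the constant function 1 and their inner products\<close>

definition u :: "nat \<Rightarrow> 'a \<Rightarrow> real" where
  "u n = (T ^^ n) (\<lambda>_. 1)"

definition \<mu> :: "nat \<Rightarrow> real" where
  "\<mu> n = (\<integral>x. u n x \<partial>M)"

definition a :: "nat \<Rightarrow> real" where
  "a n = L2_norm M (u n)"

lemma u_0 [simp]: "u 0 = (\<lambda>_. 1)"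
  by (simp add: u_def)

lemma u_Suc: "u (Suc n) = T (u n)"
  by (simp add: u_def)

lemma u_L2: "u n \<in> L2_functions M"
  by (induction n) (simp_all add: u_Suc L2_const T_L2)

lemma u_pos: "x \<in> space M \<Longrightarrow> 0 < u n x"
proof (induction n arbitrary: x)
  case (Suc n)
  then show ?case
    unfolding u_Suc using not_AE_zero_of_pos[of "u n"]
    by (intro T_pos u_L2) (auto intro: less_imp_le)
qed simp

text \<open>Symmetry moves one \<open>T\<close> at a time from the left factor to the right one,
  until the left factor is the constant 1.\<close>

lemma u_inner: "(\<integral>x. u m x * u n x \<partial>M) = \<mu> (m + n)"
proof (induction m arbitrary: n)
  case (Suc m)
  then show ?case
    using T_symmetric[OF u_L2[of m] u_L2[of n]] Suc[of "Suc n"] by (simp add: u_Suc)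
qed (simp add: \<mu>_def)

lemma a_power2: "(a n)\<^sup>2 = \<mu> (2 * n)"
  using u_inner[of n n] unfolding a_def L2_norm_power2 by (simp add: power2_eq_square mult_2)

lemma \<mu>_pos: "0 < \<mu> n"
  unfolding \<mu>_def using integral_less_AE_space[of "\<lambda>_. 0" "u n"] L2_integrable[OF u_L2] u_pos M_nonzero
  by simp

lemma a_pos: "0 < a n"
proof -
  have "a n \<noteq> 0" using a_power2[of n] \<mu>_pos[of "2 * n"] by auto
  moreover have "0 \<le> a n" by (simp add: a_def)
  ultimately show ?thesis by simp
qed

lemma \<mu>_add_le: "\<mu> (m + n) \<le> a m * a n"
  using L2_Cauchy_Schwarz[OF u_L2[of m] u_L2[of n]] by (simp add: u_inner a_def)

section \<open>The exponential growth rate of the iterates\<close>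

definition r :: "nat \<Rightarrow> real" where
  "r n = a (Suc n) / a n"

lemma r_pos: "0 < r n"
  by (simp add: r_def a_pos)

lemma a_Suc: "a (Suc n) = r n * a n"
  using a_pos[of n] by (simp add: r_def)

text \<open>This is log-convexity of \<open>a\<close>: the square of \<open>a (Suc n)\<close> is
  also the inner product of \<open>u n\<close> and \<open>u (n + 2)\<close>, to which Cauchy-Schwarz
  applies.\<close>

lemma r_incseq: "incseq r"
proof (rule incseq_SucI)
  fix n
  have "(a (Suc n))\<^sup>2 \<le> a n * a (Suc (Suc n))"
    using \<mu>_add_le[of n "Suc (Suc n)"] by (simp add: a_power2 mult_2)
  then show "r n \<le> r (Suc n)"
    using a_pos[of n] a_pos[of "Suc n"] by (simp add: r_def field_simps power2_eq_square)
qed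

lemma r_le: "r n \<le> L2_norm M K"
  using T_norm_bound[OF u_L2[of n]] a_pos[of n] by (simp add: r_def a_def u_Suc field_simps)

definition lam :: real where
  "lam = lim r"

lemma r_tendsto: "r \<longlonglongrightarrow> lam"
proof -
  obtain l where "r \<longlonglongrightarrow> l"
    using incseq_convergent[OF r_incseq, of "L2_norm M K"] r_le by blast
  then show ?thesis unfolding lam_def by (simp add: limI)
qed

lemma r_le_lam: "r n \<le> lam"
  using incseq_le[OF r_incseq r_tendsto] .

lemma lam_pos: "0 < lam"
  using r_pos[of 0] r_le_lam[of 0] by simp

lemma a_Suc_le: "a (Suc n) \<le> lam * a n"
  using r_le_lam[of n] a_pos[of n] by (simp add: a_Suc)

lemma a_le: "a n \<le> a 0 * lam ^ n"
proof (induction n)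
  case (Suc n)
  have "a (Suc n) \<le> lam * a n" by (rule a_Suc_le)
  also have "\<dots> \<le> lam * (a 0 * lam ^ n)" using Suc lam_pos by simp
  finally show ?case by (simp add: mult_ac)
qed simp

lemma a_ratio_tendsto: "(\<lambda>m. a (m + j) / a m) \<longlonglongrightarrow> lam ^ j"
proof (induction j)
  case (Suc j)
  have "(\<lambda>m. r (m + j) * (a (m + j) / a m)) \<longlonglongrightarrow> lam * lam ^ j"
    by (intro tendsto_mult LIMSEQ_ignore_initial_segment[OF r_tendsto] Suc)
  then show ?case by (simp add: a_Suc)
next
  case 0
  have "a m / a m = 1" for m using a_pos[of m] by simp
  then show ?case by simp
qed

text \<open>
  The mass of \<open>u n\<close> cannot escape into the region where \<open>B\<close> is large, since there \<open>u (Suc n)\<close>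
  is dominated by a multiple of the square integrable \<open>K\<close>. This replaces the compactness of \<open>T\<close>.
\<close>
lemma a_le_\<mu>: "\<exists>c>0. \<forall>n. c * a n \<le> \<mu> n"
proof -
  \<comment> \<open>Half of the lower bound \<open>(r 0)\<^sup>2\<close> for the squared ratios: the
    tail may consume one half of the squared norm of \<open>u (Suc n)\<close>, and the other half is
    left for the part where \<open>B\<close> is at most \<open>R\<close>.\<close>
  define \<epsilon> where "\<epsilon> = (r 0)\<^sup>2 / 2"
  have "\<epsilon> > 0" using r_pos[of 0] by (simp add: \<epsilon>_def)
  have K2: "integrable M (\<lambda>x. (K x)\<^sup>2)" using L2_functionsD(2)[OF K_L2] .
  have [measurable]: "K \<in> borel_measurable M" using L2_functionsD(1)[OF K_L2] .
  have "(\<lambda>R. \<integral>x. (if real R < B x then (K x)\<^sup>2 else 0) \<partial>M) \<longlonglongrightarrow> (\<integral>x. 0 \<partial>M)"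
  proof (rule integral_dominated_convergence[OF _ _ K2])
    show "AE x in M. (\<lambda>R. if real R < B x then (K x)\<^sup>2 else 0) \<longlonglongrightarrow> 0"
    proof (intro AE_I2 tendsto_eventually)
      fix x
      show "\<forall>\<^sub>F R in sequentially. (if real R < B x then (K x)\<^sup>2 else 0) = 0"
        using eventually_ge_at_top[of "nat \<lceil>B x\<rceil>"]
        by eventually_elim (simp add: nat_le_iff ceiling_le_iff)
    qed
  qed auto
  then have "\<forall>\<^sub>F R in sequentially. (\<integral>x. (if real R < B x then (K x)\<^sup>2 else 0) \<partial>M) < \<epsilon>"
    using \<open>\<epsilon> > 0\<close> by (intro order_tendstoD) auto
  then obtain R where R: "(\<integral>x. (if real R < B x then (K x)\<^sup>2 else 0) \<partial>M) < \<epsilon>"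
    by (auto simp: eventually_sequentially)
  define V where "V = measure M (space M)"
  have tail_int: "integrable M (\<lambda>x. if real R < B x then (K x)\<^sup>2 else 0)"
    by (rule Bochner_Integration.integrable_bound[OF K2]) auto
  have step: "\<epsilon> * (a n)\<^sup>2 \<le> (real R)\<^sup>2 * V * (\<mu> n)\<^sup>2" for n
  proof -
    have "(r 0)\<^sup>2 * (a n)\<^sup>2 \<le> (r n)\<^sup>2 * (a n)\<^sup>2"
      using r_pos[of 0] incseqD[OF r_incseq, of 0 n] by (intro mult_right_mono power_mono) auto
    also have "\<dots> = (\<integral>x. (u (Suc n) x)\<^sup>2 \<partial>M)"
      unfolding power_mult_distrib[symmetric] a_Suc[symmetric] by (simp add: a_def L2_norm_power2)
    also have "\<dots> \<le> (\<integral>x. (real R)\<^sup>2 * (\<mu> n)\<^sup>2 + (a n)\<^sup>2 * (if real R < B x then (K x)\<^sup>2 else 0) \<partial>M)"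
    proof (rule integral_mono)
      show "integrable M (\<lambda>x. (u (Suc n) x)\<^sup>2)" using L2_functionsD(2)[OF u_L2] .
      show "integrable M (\<lambda>x. (real R)\<^sup>2 * (\<mu> n)\<^sup>2 + (a n)\<^sup>2 * (if real R < B x then (K x)\<^sup>2 else 0))"
        using tail_int by simp
      fix x assume x: "x \<in> space M"
      show "(u (Suc n) x)\<^sup>2 \<le> (real R)\<^sup>2 * (\<mu> n)\<^sup>2 + (a n)\<^sup>2 * (if real R < B x then (K x)\<^sup>2 else 0)"
      proof (cases "real R < B x")
        case True
        \<comment> \<open>Where \<open>B\<close> is large, the Cauchy-Schwarz bound by
          \<open>K x\<close> is used; elsewhere \<open>k x y \<le> B x \<le> R\<close> bounds
          \<open>u (Suc n) x\<close> by \<open>R\<close> times the mass of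
          \<open>u n\<close>.\<close>
        have "(u (Suc n) x)\<^sup>2 \<le> (K x * a n)\<^sup>2"
          using power_mono[OF T_bound[OF u_L2 x, of n], of 2] by (simp add: u_Suc a_def)
        then show ?thesis using True by (simp add: power_mult_distrib mult.commute add_increasing)
      next
        case False
        have "u (Suc n) x \<le> (\<integral>y. B x * u n y \<partial>M)"
          unfolding u_Suc T_def using x L2_integrable[OF u_L2[of n]] u_pos[of _ n] k_le[OF x]
          by (intro integral_mono T_integrable u_L2) (auto simp: mult.commute intro!: mult_right_mono less_imp_le)
        also have "\<dots> \<le> real R * \<mu> n"
          using False \<mu>_pos[of n] by (simp add: \<mu>_def[symmetric] mult_right_mono)
        finally have "(u (Suc n) x)\<^sup>2 \<le> (real R * \<mu> n)\<^sup>2"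
          using u_pos[OF x, of "Suc n"] by (intro power_mono) auto
        then show ?thesis using False by (simp add: power_mult_distrib)
      qed
    qed
    also have "\<dots> = (real R)\<^sup>2 * (\<mu> n)\<^sup>2 * V + (a n)\<^sup>2 * (\<integral>x. (if real R < B x then (K x)\<^sup>2 else 0) \<partial>M)"
      using tail_int by (simp add: V_def mult.commute)
    also have "\<dots> \<le> (real R)\<^sup>2 * (\<mu> n)\<^sup>2 * V + (a n)\<^sup>2 * \<epsilon>"
      using R by (intro add_left_mono mult_left_mono) auto
    finally show ?thesis by (simp add: \<epsilon>_def field_simps)
  qed
  define c where "c = sqrt (\<epsilon> / ((real R)\<^sup>2 * V))"
  \<comment> \<open>This excludes \<open>R = 0\<close>: in \<open>step 0\<close> the left side is
    strictly positive.\<close>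
  have "(real R)\<^sup>2 * V > 0"
  proof -
    have "0 < \<epsilon> * (a 0)\<^sup>2" using \<open>\<epsilon> > 0\<close> a_pos[of 0] by simp
    with step[of 0] have "0 < (real R)\<^sup>2 * V * (\<mu> 0)\<^sup>2" by linarith
    then show ?thesis by (simp add: zero_less_mult_iff)
  qed
  then have "c > 0" "c\<^sup>2 = \<epsilon> / ((real R)\<^sup>2 * V)" using \<open>\<epsilon> > 0\<close> by (auto simp: c_def)
  have "c * a n \<le> \<mu> n" for n
  proof (rule power2_le_imp_le)
    show "(c * a n)\<^sup>2 \<le> (\<mu> n)\<^sup>2"
      using step[of n] \<open>(real R)\<^sup>2 * V > 0\<close>
      by (simp add: power_mult_distrib \<open>c\<^sup>2 = _\<close> pos_divide_le_eq mult_ac)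
  qed (use \<mu>_pos[of n] in simp)
  with \<open>c > 0\<close> show ?thesis by blast
qed

text \<open>Squaring \<open>c * a (m + j)\<close> produces \<open>\<mu> (2 * m + 2 * j)\<close>,
  which Cauchy-Schwarz splits into \<open>a (2 * m) * a (2 * j)\<close>; by the preceding lemma each
  factor, times \<open>c\<close>, is at most \<open>\<mu> (2 * m) = (a m)\<^sup>2\<close> or its
  analogue for \<open>j\<close>. Dividing \<open>c * a (m + j) \<le> a m * a j\<close> by
  \<open>a m\<close> and letting \<open>m\<close> tend to infinity with \<open>j\<close> fixed gives
  the claim.\<close>

lemma a_ge: "\<exists>c>0. \<forall>j. c * lam ^ j \<le> a j"
proof -
  obtain c where c: "c > 0" "\<And>n. c * a n \<le> \<mu> n" using a_le_\<mu> by blast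
  have "c * lam ^ j \<le> a j" for j
  proof (rule tendsto_le[OF _ tendsto_const])
    show "(\<lambda>m. c * (a (m + j) / a m)) \<longlonglongrightarrow> c * lam ^ j"
      by (intro tendsto_mult a_ratio_tendsto tendsto_const)
    have "c * a (m + j) \<le> a m * a j" for m
    proof (rule power2_le_imp_le)
      have "(c * a (m + j))\<^sup>2 = c\<^sup>2 * \<mu> (2 * m + 2 * j)"
        by (simp add: power_mult_distrib a_power2)
      also have "\<dots> \<le> c\<^sup>2 * (a (2 * m) * a (2 * j))"
        by (intro mult_left_mono \<mu>_add_le) auto
      also have "\<dots> = (c * a (2 * m)) * (c * a (2 * j))"
        by (simp add: power2_eq_square)
      also have "\<dots> \<le> \<mu> (2 * m) * \<mu> (2 * j)"
        using c(1) by (intro mult_mono c(2) mult_nonneg_nonneg less_imp_le a_pos \<mu>_pos)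
      finally show "(c * a (m + j))\<^sup>2 \<le> (a m * a j)\<^sup>2"
        by (simp add: power_mult_distrib a_power2)
    qed (intro mult_nonneg_nonneg less_imp_le a_pos)
    then have "c * (a (m + j) / a m) \<le> a j" for m
      using a_pos[of m] by (simp add: pos_divide_le_eq mult.commute[of _ "a m"])
    then show "\<forall>\<^sub>F m in sequentially. c * (a (m + j) / a m) \<le> a j"
      by simp
  qed simp
  with c(1) show ?thesis by blast
qed

section \<open>Convergence of the normalised iterates\<close>

definition s :: "nat \<Rightarrow> real" where
  "s n = (a n / lam ^ n)\<^sup>2"

lemma s_decseq: "decseq s"
proof (rule decseq_SucI)
  fix n
  have "a (Suc n) / lam ^ Suc n \<le> lam * a n / lam ^ Suc n"
    using a_Suc_le[of n] lam_pos by (intro divide_right_mono) auto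
  then have "a (Suc n) / lam ^ Suc n \<le> a n / lam ^ n"
    using lam_pos by simp
  then show "s (Suc n) \<le> s n"
    unfolding s_def using lam_pos a_pos[of "Suc n"] by (intro power_mono) auto
qed

text \<open>The sequence decreases, and \<open>a_ge\<close> keeps it away from 0. This positive
  limit is what later prevents the limit function from vanishing.\<close>

lemma s_tendsto: "\<exists>l>0. s \<longlonglongrightarrow> l"
proof -
  obtain c where c: "c > 0" "\<And>n. c * lam ^ n \<le> a n" using a_ge by blast
  have ge: "c\<^sup>2 \<le> s n" for n
    unfolding s_def using c(1) c(2)[of n] lam_pos by (intro power_mono) (simp_all add: field_simps)
  obtain l where l: "s \<longlonglongrightarrow> l"
    using decseq_convergent[OF s_decseq, of "c\<^sup>2"] ge by blast
  have "c\<^sup>2 \<le> l" using l ge by (intro tendsto_lowerbound[OF l]) auto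
  moreover have "0 < c\<^sup>2" using c(1) by simp
  ultimately have "0 < l" by linarith
  then show ?thesis using l by blast
qed

definition w :: "nat \<Rightarrow> 'a \<Rightarrow> real" where
  "w n x = u n x / lam ^ n"

lemma w_L2: "w n \<in> L2_functions M"
  using L2_cmult[OF u_L2[of n], of "1 / lam ^ n"] by (simp add: w_def[abs_def])

lemma w_pos: "x \<in> space M \<Longrightarrow> 0 < w n x"
  using u_pos lam_pos by (simp add: w_def)

lemma w_Suc: "w (Suc n) x = T (w n) x / lam"
  using T_cmult[of "1 / lam ^ n" "u n" x] by (simp add: w_def[abs_def] u_Suc)

text \<open>Even indices are chosen because \<open>\<mu>\<close> at an even index is a squared norm,
  so that the inner product is again a value of \<open>s\<close>.\<close>

lemma w_inner: "(\<integral>x. w (2 * i) x * w (2 * j) x \<partial>M) = s (i + j)"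
proof -
  have "(\<integral>x. w (2 * i) x * w (2 * j) x \<partial>M) = (\<integral>x. u (2 * i) x * u (2 * j) x / lam ^ (2 * (i + j)) \<partial>M)"
    by (simp add: w_def power_add)
  also have "\<dots> = (\<integral>x. u (2 * i) x * u (2 * j) x \<partial>M) / lam ^ (2 * (i + j))"
    by simp
  also have "\<dots> = s (i + j)"
    by (simp add: s_def u_inner power_divide a_power2 power_mult[symmetric] mult.commute)
  finally show ?thesis .
qed

lemma w_norm: "(\<integral>x. (w n x)\<^sup>2 \<partial>M) = s n"
  by (simp add: w_def s_def power_divide a_def L2_norm_power2)

text \<open>Since \<open>s\<close> converges, the right-hand side tends to 0, so the even iterates
  form a Cauchy sequence in L2.\<close>

lemma w_diff_norm: "(L2_norm M (\<lambda>x. w (2 * i) x - w (2 * j) x))\<^sup>2 = s (2 * i) + s (2 * j) - 2 * s (i + j)"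
proof -
  note int = L2_mult_integrable[OF w_L2 w_L2]
  have "(L2_norm M (\<lambda>x. w (2 * i) x - w (2 * j) x))\<^sup>2
    = (\<integral>x. w (2*i) x * w (2*i) x + w (2*j) x * w (2*j) x - 2 * (w (2*i) x * w (2*j) x) \<partial>M)"
    unfolding L2_norm_power2
    by (intro Bochner_Integration.integral_cong) (auto simp: power2_eq_square algebra_simps)
  also have "\<dots> = s (2 * i) + s (2 * j) - 2 * s (i + j)"
    using int by (simp add: w_inner mult_2[symmetric])
  finally show ?thesis .
qed

text \<open>A square integrable majorant that does not depend on \<open>n\<close>, for use in
  dominated convergence.\<close>

lemma w_bound:
  assumes "x \<in> space M"
  shows "w (Suc n) x \<le> a 0 / lam * K x"
proof -
  have "u (Suc n) x \<le> K x * a n" using T_bound[OF u_L2 assms, of n] by (simp add: u_Suc a_def)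
  also have "\<dots> \<le> K x * (a 0 * lam ^ n)" using a_le K_nonneg by (intro mult_left_mono)
  finally show ?thesis using lam_pos by (simp add: w_def field_simps)
qed

text \<open>Odd iterates are images of even ones under \<open>T / lam\<close>, and
  \<open>T_bound\<close> turns their L2 distance into a pointwise one at the cost of the factor
  \<open>K x\<close>.\<close>

lemma w_odd_Cauchy:
  assumes x: "x \<in> space M"
  shows "Cauchy (\<lambda>i. w (Suc (2 * i)) x)"
proof (rule CauchyI)
  fix e :: real assume "e > 0"
  obtain l where l: "s \<longlonglongrightarrow> l" using s_tendsto by blast
  \<comment> \<open>Chosen so that \<open>(K x + 1) * d / lam = e\<close>; the summand 1 avoids
    dividing by \<open>K x\<close>, of which only nonnegativity is known.\<close>
  define d where "d = e * lam / (K x + 1)"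
  have "d > 0" using \<open>e > 0\<close> lam_pos K_nonneg[of x] by (simp add: d_def add_nonneg_pos)
  then have "\<forall>\<^sub>F n in sequentially. dist (s n) l < d\<^sup>2 / 4"
    by (intro tendstoD[OF l]) auto
  then obtain N where N: "\<And>n. n \<ge> N \<Longrightarrow> dist (s n) l < d\<^sup>2 / 4"
    by (auto simp: eventually_sequentially)
  have "norm (w (Suc (2 * i)) x - w (Suc (2 * j)) x) < e" if "i \<ge> N" "j \<ge> N" for i j
  proof -
    define D where "D = L2_norm M (\<lambda>x. w (2 * i) x - w (2 * j) x)"
    \<comment> \<open>In \<open>s (2 * i) + s (2 * j) - 2 * s (i + j)\<close> the limits cancel,
      leaving four errors of less than \<open>d\<^sup>2 / 4\<close> each.\<close>
    have "D\<^sup>2 < d\<^sup>2"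
      using N[of "2 * i"] N[of "2 * j"] N[of "i + j"] that
      unfolding D_def w_diff_norm dist_real_def by linarith
    then have "D < d" using \<open>d > 0\<close> by (simp add: power_less_imp_less_base)
    have "norm (w (Suc (2 * i)) x - w (Suc (2 * j)) x) = \<bar>T (\<lambda>x. w (2 * i) x - w (2 * j) x) x\<bar> / lam"
      using lam_pos by (simp add: T_diff[OF w_L2 w_L2 x] w_Suc flip: diff_divide_distrib)
    also have "\<dots> \<le> K x * D / lam"
      unfolding D_def using lam_pos x by (intro divide_right_mono T_bound L2_diff w_L2) auto
    also have "\<dots> \<le> (K x + 1) * D / lam"
      using lam_pos by (intro divide_right_mono mult_right_mono) (auto simp: D_def)
    also have "\<dots> < (K x + 1) * d / lam"
      using lam_pos K_nonneg[of x] \<open>D < d\<close> by (intro divide_strict_right_mono mult_strict_left_mono) auto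
    also have "\<dots> = e" using lam_pos K_nonneg[of x] by (simp add: d_def)
    finally show ?thesis .
  qed
  then show "\<exists>N. \<forall>i\<ge>N. \<forall>j\<ge>N. norm (w (Suc (2 * i)) x - w (Suc (2 * j)) x) < e" by blast
qed

lemma T_dominated_tendsto:
  assumes g: "g \<in> L2_functions M" and f: "\<And>n. f n \<in> L2_functions M" "f' \<in> borel_measurable M"
    and lim: "\<And>y. y \<in> space M \<Longrightarrow> (\<lambda>n. f n y) \<longlonglongrightarrow> f' y"
    and le: "\<And>n y. y \<in> space M \<Longrightarrow> \<bar>f n y\<bar> \<le> g y" and x: "x \<in> space M"
  shows "(\<lambda>n. T (f n) x) \<longlonglongrightarrow> T f' x"
  unfolding T_def
proof (rule integral_dominated_convergence)
  show "integrable M (\<lambda>y. g y * k x y)" by (rule T_integrable[OF g x])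
  show "AE y in M. (\<lambda>n. f n y * k x y) \<longlonglongrightarrow> f' y * k x y"
    using lim by (intro AE_I2 tendsto_mult tendsto_const)
  show "AE y in M. norm (f n y * k x y) \<le> g y * k x y" for n
    using le k_pos[of x] by (intro AE_I2) (auto simp: abs_mult abs_of_pos intro!: mult_right_mono less_imp_le)
  show "(\<lambda>y. f n y * k x y) \<in> borel_measurable M" for n
    using T_integrable[OF f(1) x] by (rule borel_measurable_integrable)
  show "(\<lambda>y. f' y * k x y) \<in> borel_measurable M"
    using f(2) x by measurable
qed

text \<open>
  The even and the odd powers of \<open>T\<close> have separate limits here, which avoids the argument that \<open>- lam\<close>
  is not an eigenvalue of \<open>T\<close>.
\<close>
lemma w_limits:
  obtains v\<^sub>0 v\<^sub>1 where
    "\<And>x. x \<in> space M \<Longrightarrow> (\<lambda>i. w (2 * i) x) \<longlonglongrightarrow> v\<^sub>0 x"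
    "\<And>x. x \<in> space M \<Longrightarrow> (\<lambda>i. w (Suc (2 * i)) x) \<longlonglongrightarrow> v\<^sub>1 x"
    "v\<^sub>0 \<in> L2_functions M" "v\<^sub>1 \<in> L2_functions M"
    "\<And>x. x \<in> space M \<Longrightarrow> T v\<^sub>0 x = lam * v\<^sub>1 x" "\<And>x. x \<in> space M \<Longrightarrow> T v\<^sub>1 x = lam * v\<^sub>0 x"
    "\<And>x. x \<in> space M \<Longrightarrow> 0 < v\<^sub>0 x" "\<And>x. x \<in> space M \<Longrightarrow> 0 < v\<^sub>1 x"
proof -
  define v\<^sub>1 where "v\<^sub>1 x = lim (\<lambda>i. w (Suc (2 * i)) x)" for x
  \<comment> \<open>Pointwise convergence is known for odd indices only, so the even limit is
    introduced as an image under \<open>T\<close>; dominated convergence then identifies it as the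
    limit.\<close>
  define v\<^sub>0 where "v\<^sub>0 x = T v\<^sub>1 x / lam" for x
  note [measurable] = L2_functionsD(1)[OF w_L2]
  define g where "g x = a 0 / lam * K x" for x
  have g: "g \<in> L2_functions M" unfolding g_def by (intro L2_cmult K_L2)
  have wg: "\<bar>w (Suc n) x\<bar> \<le> g x" if "x \<in> space M" for n x
    using w_bound[OF that, of n] w_pos[OF that, of "Suc n"] by (simp add: g_def)
  have lim1: "(\<lambda>i. w (Suc (2 * i)) x) \<longlonglongrightarrow> v\<^sub>1 x" if "x \<in> space M" for x
    using w_odd_Cauchy[OF that] unfolding v\<^sub>1_def
    by (simp add: Cauchy_convergent_iff convergent_LIMSEQ_iff)
  have [measurable]: "v\<^sub>1 \<in> borel_measurable M"
    by (rule borel_measurable_LIMSEQ_real[OF lim1]) auto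
  have v1: "v\<^sub>1 \<in> L2_functions M"
  proof (rule L2_dominated[OF g])
    fix x assume x: "x \<in> space M"
    show "\<bar>v\<^sub>1 x\<bar> \<le> g x"
      by (rule tendsto_upperbound[OF tendsto_rabs[OF lim1[OF x]]]) (auto intro!: always_eventually wg x)
  qed auto
  have v0: "v\<^sub>0 \<in> L2_functions M"
    using L2_cmult[OF T_L2[OF v1], of "1 / lam"] by (simp add: v\<^sub>0_def[abs_def])
  have v1_nonneg: "0 \<le> v\<^sub>1 x" if "x \<in> space M" for x
    by (rule tendsto_lowerbound[OF lim1[OF that]]) (auto intro!: always_eventually less_imp_le w_pos that)
  \<comment> \<open>The sequence starts at index 2 because \<open>w 0\<close> is not the image of an
    earlier iterate.\<close>
  have lim0': "(\<lambda>i. w (Suc (Suc (2 * i))) x) \<longlonglongrightarrow> v\<^sub>0 x" if "x \<in> space M" for x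
    unfolding w_Suc[of "Suc _"] v\<^sub>0_def
    by (intro tendsto_divide tendsto_const T_dominated_tendsto[OF g]) (use lam_pos wg w_L2 lim1 that in auto)
  then have lim0: "(\<lambda>i. w (2 * i) x) \<longlonglongrightarrow> v\<^sub>0 x" if "x \<in> space M" for x
    using LIMSEQ_imp_Suc[of "\<lambda>i. w (2 * i) x"] that by simp
  have T0: "T v\<^sub>0 x = lam * v\<^sub>1 x" if "x \<in> space M" for x
  proof (rule LIMSEQ_unique)
    show "(\<lambda>i. T (w (Suc (Suc (2 * i)))) x) \<longlonglongrightarrow> T v\<^sub>0 x"
      by (intro T_dominated_tendsto[OF g]) (use wg w_L2 lim0' L2_functionsD(1)[OF v0] that in auto)
    have "(\<lambda>i. lam * w (Suc (2 * Suc i)) x) \<longlonglongrightarrow> lam * v\<^sub>1 x"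
      by (intro tendsto_mult tendsto_const LIMSEQ_Suc[OF lim1] that)
    then show "(\<lambda>i. T (w (Suc (Suc (2 * i)))) x) \<longlonglongrightarrow> lam * v\<^sub>1 x"
      using lam_pos by (simp add: w_Suc[of "Suc (Suc _)"])
  qed
  have T1: "T v\<^sub>1 x = lam * v\<^sub>0 x" if "x \<in> space M" for x
    using lam_pos by (simp add: v\<^sub>0_def)
  obtain l where l: "l > 0" "s \<longlonglongrightarrow> l" using s_tendsto by blast
  \<comment> \<open>The squared norm of the odd limit equals the positive limit of \<open>s\<close>,
    so this function is not zero almost everywhere; positivity of \<open>T\<close> then makes both
    limits strictly positive.\<close>
  have "(\<lambda>i. \<integral>x. (w (Suc (2 * i)) x)\<^sup>2 \<partial>M) \<longlonglongrightarrow> (\<integral>x. (v\<^sub>1 x)\<^sup>2 \<partial>M)"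
  proof (rule integral_dominated_convergence)
    show "integrable M (\<lambda>x. (g x)\<^sup>2)" by (rule L2_functionsD(2)[OF g])
    show "AE x in M. (\<lambda>i. (w (Suc (2 * i)) x)\<^sup>2) \<longlonglongrightarrow> (v\<^sub>1 x)\<^sup>2"
      using lim1 by (intro AE_I2 tendsto_power)
    show "AE x in M. norm ((w (Suc (2 * i)) x)\<^sup>2) \<le> (g x)\<^sup>2" for i
      using power_mono[OF wg, of _ _ 2] by (intro AE_I2) simp
  qed auto
  moreover have "(\<lambda>i. s (Suc (2 * i))) \<longlonglongrightarrow> l"
    using LIMSEQ_subseq_LIMSEQ[OF l(2), of "\<lambda>i. Suc (2 * i)"] by (simp add: strict_mono_def o_def)
  ultimately have "(\<integral>x. (v\<^sub>1 x)\<^sup>2 \<partial>M) = l"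
    by (simp add: w_norm LIMSEQ_unique)
  moreover have "(\<integral>x. (v\<^sub>1 x)\<^sup>2 \<partial>M) = 0" if "AE x in M. v\<^sub>1 x = 0"
    by (rule integral_eq_zero_AE) (use that in auto)
  ultimately have nz: "\<not> (AE x in M. v\<^sub>1 x = 0)"
    using l(1) by auto
  have pos0: "0 < v\<^sub>0 x" if "x \<in> space M" for x
    using T_pos[OF v1 v1_nonneg nz that] lam_pos by (simp add: v\<^sub>0_def)
  have pos1: "0 < v\<^sub>1 x" if "x \<in> space M" for x
  proof -
    have "0 < T v\<^sub>0 x"
      by (rule T_pos[OF v0 _ not_AE_zero_of_pos that]) (auto intro: less_imp_le pos0)
    then show ?thesis using T0[OF that] lam_pos by (simp add: zero_less_mult_iff)
  qed
  show thesis by (rule that[OF lim0 lim1 v0 v1 T0 T1 pos0 pos1])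
qed

section \<open>The principal eigenvalue and the two-sided pointwise bound\<close>

lemma positive_eigenfunction:
  obtains h where "h \<in> L2_functions M" "\<And>x. x \<in> space M \<Longrightarrow> 0 < h x"
    "\<And>x. x \<in> space M \<Longrightarrow> T h x = lam * h x"
proof -
  obtain v\<^sub>0 v\<^sub>1 where v: "v\<^sub>0 \<in> L2_functions M" "v\<^sub>1 \<in> L2_functions M"
    "\<And>x. x \<in> space M \<Longrightarrow> T v\<^sub>0 x = lam * v\<^sub>1 x" "\<And>x. x \<in> space M \<Longrightarrow> T v\<^sub>1 x = lam * v\<^sub>0 x"
    "\<And>x. x \<in> space M \<Longrightarrow> 0 < v\<^sub>0 x" "\<And>x. x \<in> space M \<Longrightarrow> 0 < v\<^sub>1 x"
    by (rule w_limits) blast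
  \<comment> \<open>\<open>T\<close> exchanges the two limits up to the factor \<open>lam\<close>,
    so their sum is an eigenfunction.\<close>
  show thesis
    using v by (intro that[of "\<lambda>x. v\<^sub>0 x + v\<^sub>1 x"]) (auto simp: L2_add T_add algebra_simps add_pos_pos)
qed

text \<open>For an eigenfunction \<open>f\<close> with eigenvalue \<open>l\<close>, the absolute
  value \<open>F\<close> satisfies \<open>l * F \<le> T F\<close>. Integrating against the positive
  eigenfunction \<open>h\<close> and moving \<open>T\<close> onto \<open>h\<close> compares
  \<open>l\<close> with \<open>lam\<close>, since the pairing of \<open>F\<close> and
  \<open>h\<close> is strictly positive.\<close>

lemma lam_largest_eigenvalue: "L2_largest_eigenvalue M T lam"
proof -
  obtain h where h: "h \<in> L2_functions M" "\<And>x. x \<in> space M \<Longrightarrow> 0 < h x"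
    "\<And>x. x \<in> space M \<Longrightarrow> T h x = lam * h x"
    by (rule positive_eigenfunction) blast
  have "L2_eigenvalue M T lam"
    unfolding L2_eigenvalue_def using h not_AE_zero_of_pos[of h] by (intro bexI[of _ h]) auto
  moreover have "l \<le> lam" if l: "L2_eigenvalue M T l" for l
  proof -
    obtain f where f: "f \<in> L2_functions M" "\<not> (AE x in M. f x = 0)" "AE x in M. T f x = l * f x"
      using l by (auto simp: L2_eigenvalue_def)
    define F where "F x = \<bar>f x\<bar>" for x
    have F: "F \<in> L2_functions M" unfolding F_def by (rule L2_abs[OF f(1)])
    note Fh = L2_mult_integrable[OF F h(1)]
    have T_abs: "\<bar>T f x\<bar> \<le> T F x" if "x \<in> space M" for x
    proof -
      have "\<bar>T f x\<bar> \<le> (\<integral>y. \<bar>f y * k x y\<bar> \<partial>M)" unfolding T_def by (rule integral_abs_bound)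
      also have "\<dots> = T F x" using k_pos[of x] by (simp add: T_def F_def abs_mult abs_of_pos)
      finally show ?thesis .
    qed
    from f(3) AE_space have AE_le: "AE x in M. l * F x \<le> T F x"
    proof eventually_elim
      case (elim x)
      have "l * F x \<le> \<bar>l\<bar> * \<bar>f x\<bar>" unfolding F_def by (intro mult_right_mono) auto
      also have "\<dots> = \<bar>T f x\<bar>" by (simp add: elim(1) abs_mult)
      also have "\<dots> \<le> T F x" by (rule T_abs[OF elim(2)])
      finally show ?case .
    qed
    have "l * (\<integral>x. F x * h x \<partial>M) = (\<integral>x. l * F x * h x \<partial>M)"
      by (simp add: mult.assoc)
    also have "\<dots> \<le> (\<integral>x. T F x * h x \<partial>M)"
    proof (rule integral_mono_AE)
      show "integrable M (\<lambda>x. l * F x * h x)" using Fh by (simp add: mult.assoc)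
      show "integrable M (\<lambda>x. T F x * h x)" by (intro L2_mult_integrable T_L2 F h)
      show "AE x in M. l * F x * h x \<le> T F x * h x"
        using AE_le AE_space
        by eventually_elim (rule mult_right_mono[OF _ less_imp_le[OF h(2)]])
    qed
    also have "\<dots> = (\<integral>x. F x * T h x \<partial>M)" by (rule T_symmetric[OF F h(1)])
    also have "\<dots> = (\<integral>x. lam * (F x * h x) \<partial>M)"
      using h(3) by (intro Bochner_Integration.integral_cong) auto
    also have "\<dots> = lam * (\<integral>x. F x * h x \<partial>M)" by simp
    finally have *: "l * (\<integral>x. F x * h x \<partial>M) \<le> lam * (\<integral>x. F x * h x \<partial>M)" .
    have nn: "AE x in M. 0 \<le> F x * h x"
      using h(2) by (intro AE_I2) (simp add: F_def less_imp_le)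
    have "(\<integral>x. F x * h x \<partial>M) \<noteq> 0"
    proof
      assume "(\<integral>x. F x * h x \<partial>M) = 0"
      then have "AE x in M. F x * h x = 0"
        by (subst (asm) integral_nonneg_eq_0_iff_AE[OF Fh nn])
      then have "AE x in M. f x = 0"
        using AE_space
      proof eventually_elim
        case (elim x)
        then show ?case using h(2)[OF elim(2)] by (simp add: F_def)
      qed
      then show False using f(2) by simp
    qed
    moreover have "0 \<le> (\<integral>x. F x * h x \<partial>M)" using nn by (rule integral_nonneg_AE)
    ultimately have "0 < (\<integral>x. F x * h x \<partial>M)" by linarith
    with * show ?thesis by (rule mult_right_le_imp_le)
  qed
  ultimately show ?thesis by (simp add: L2_largest_eigenvalue_def)
qed

text \<open>The eigenvalue equation of the positive \<open>h\<close> is integrated, and symmetry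
  moves \<open>T\<close> onto the constant 1.\<close>

lemma lam_less_1:
  assumes "\<And>x. x \<in> space M \<Longrightarrow> T (\<lambda>_. 1) x < 1"
  shows "lam < 1"
proof -
  obtain h where h: "h \<in> L2_functions M" "\<And>x. x \<in> space M \<Longrightarrow> 0 < h x"
    "\<And>x. x \<in> space M \<Longrightarrow> T h x = lam * h x"
    by (rule positive_eigenfunction) blast
  note L2 = L2_const[of 1]
  have "lam * (\<integral>x. h x \<partial>M) = (\<integral>x. T h x * 1 \<partial>M)"
    using h(3) by (simp cong: Bochner_Integration.integral_cong)
  also have "\<dots> = (\<integral>x. h x * T (\<lambda>_. 1) x \<partial>M)" by (rule T_symmetric[OF h(1) L2])
  also have "\<dots> < (\<integral>x. h x \<partial>M)"
    using assms h(2) M_nonzero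
    by (intro integral_less_AE_space L2_mult_integrable L2_integrable h(1) T_L2 L2 AE_I2) auto
  finally have "lam * (\<integral>x. h x \<partial>M) < 1 * (\<integral>x. h x \<partial>M)" unfolding mult_1 .
  moreover have "0 \<le> (\<integral>x. h x \<partial>M)"
    using h(2) by (intro integral_nonneg_AE AE_I2 less_imp_le)
  ultimately show ?thesis by (rule mult_right_less_imp_less)
qed

text \<open>At a fixed \<open>x\<close> the even and the odd part of \<open>w\<close> converge to
  positive limits, so they and their reciprocals are bounded; the worse of the two constants serves
  for all \<open>n\<close>.\<close>

lemma u_asymp:
  assumes x: "x \<in> space M"
  shows "\<exists>c>0. \<exists>C>0. \<forall>n. c * lam ^ n \<le> u n x \<and> u n x \<le> C * lam ^ n"
proof -
  have bounds: "\<exists>c>0. \<exists>C>0. \<forall>n. c \<le> f n \<and> f n \<le> C"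
    if f: "f \<longlonglongrightarrow> l" "l > 0" "\<And>n. f n > 0" for f :: "nat \<Rightarrow> real" and l
  proof -
    have "Bseq f" "Bseq (\<lambda>n. inverse (f n))"
      using f tendsto_inverse[OF f(1)] by (auto intro!: convergent_imp_Bseq convergentI)
    then obtain C D where C: "C > 0" "\<And>n. norm (f n) \<le> C" and D: "D > 0" "\<And>n. norm (inverse (f n)) \<le> D"
      by (auto elim!: BseqE)
    have "inverse D \<le> f n" for n
      using D(1) D(2)[of n] f(3)[of n] by (simp add: field_simps)
    moreover have "f n \<le> C" for n using C(2)[of n] by simp
    ultimately show ?thesis using C(1) D(1) by (intro exI[of _ "inverse D"] exI[of _ C] conjI) auto
  qed
  obtain v\<^sub>0 v\<^sub>1 where v: "(\<lambda>i. w (2 * i) x) \<longlonglongrightarrow> v\<^sub>0 x" "(\<lambda>i. w (Suc (2 * i)) x) \<longlonglongrightarrow> v\<^sub>1 x"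
    "0 < v\<^sub>0 x" "0 < v\<^sub>1 x"
    by (rule w_limits) (use x in blast)
  obtain c\<^sub>0 C\<^sub>0 where 0: "c\<^sub>0 > 0" "C\<^sub>0 > 0" "\<And>i. c\<^sub>0 \<le> w (2 * i) x" "\<And>i. w (2 * i) x \<le> C\<^sub>0"
    using bounds[OF v(1,3) w_pos[OF x]] by blast
  obtain c\<^sub>1 C\<^sub>1 where 1: "c\<^sub>1 > 0" "C\<^sub>1 > 0" "\<And>i. c\<^sub>1 \<le> w (Suc (2 * i)) x" "\<And>i. w (Suc (2 * i)) x \<le> C\<^sub>1"
    using bounds[OF v(2,4) w_pos[OF x]] by blast
  have "min c\<^sub>0 c\<^sub>1 \<le> w n x \<and> w n x \<le> max C\<^sub>0 C\<^sub>1" for n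
  proof (cases "even n")
    case True
    then obtain i where "n = 2 * i" by (rule evenE)
    then show ?thesis using 0(3,4)[of i] by auto
  next
    case False
    then obtain i where "n = Suc (2 * i)" by (auto elim: oddE)
    then show ?thesis using 1(3,4)[of i] by auto
  qed
  then have "min c\<^sub>0 c\<^sub>1 * lam ^ n \<le> u n x \<and> u n x \<le> max C\<^sub>0 C\<^sub>1 * lam ^ n" for n
    using lam_pos by (simp add: w_def pos_le_divide_eq pos_divide_le_eq)
  moreover have "min c\<^sub>0 c\<^sub>1 > 0" "max C\<^sub>0 C\<^sub>1 > 0" using 0 1 by auto
  ultimately show ?thesis by blast
qed

end

section \<open>The Gaussian kernel on the half-line\<close>

text \<open>The density vanishes nowhere, so its null sets are Lebesgue null sets.\<close>

lemma emeasure_normal_density_pos: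
  assumes "\<sigma> > 0" "A \<in> sets borel" "emeasure lborel A \<noteq> 0"
  shows "emeasure (density lborel (\<lambda>x. ennreal (normal_density m \<sigma> x))) A \<noteq> 0"
proof
  assume "emeasure (density lborel (\<lambda>x. ennreal (normal_density m \<sigma> x))) A = 0"
  then have "(\<integral>\<^sup>+x. ennreal (normal_density m \<sigma> x) * indicator A x \<partial>lborel) = 0"
    using assms(2) by (simp add: emeasure_density)
  then have "AE x in lborel. ennreal (normal_density m \<sigma> x) * indicator A x = 0"
    using assms(2) by (subst (asm) nn_integral_0_iff_AE) auto
  then have "AE x in lborel. x \<notin> A"
  proof eventually_elim
    case (elim x)
    then show ?case using normal_density_pos[OF assms(1), of m x] by (auto simp: indicator_def split: if_splits)
  qed
  then show False
    using assms(2,3) by (simp add: AE_iff_measurable[OF _ refl])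
qed

lemma space_halfline_gaussian [simp]: "space halfline_gaussian = {0..}"
  by (simp add: halfline_gaussian_def std_gaussian_def space_restrict_space)

lemma measurable_halfline_gaussian_ident [measurable]: "(\<lambda>x. x) \<in> measurable halfline_gaussian borel"
  unfolding halfline_gaussian_def std_gaussian_def by (intro measurable_restrict_space1) simp

lemma finite_measure_halfline_gaussian: "finite_measure halfline_gaussian"
  unfolding halfline_gaussian_def std_gaussian_def
  by (intro finite_measure_restrict_space prob_space.finite_measure prob_space_normal_density) auto

lemma nn_integral_halfline_gaussian:
  assumes [measurable]: "f \<in> borel_measurable borel"
  shows "(\<integral>\<^sup>+x. f x \<partial>halfline_gaussian)
    = (\<integral>\<^sup>+x. f x * indicator {0..} x * ennreal (std_normal_density x) \<partial>lborel)"
  unfolding halfline_gaussian_def std_gaussian_def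
  by (subst nn_integral_restrict_space) (auto simp: nn_integral_density mult_ac)

lemma emeasure_halfline_gaussian_space: "emeasure halfline_gaussian {0..} \<noteq> 0"
proof -
  have "emeasure halfline_gaussian {0..} = emeasure std_gaussian {0..}"
    unfolding halfline_gaussian_def by (rule emeasure_restrict_space) (auto simp: std_gaussian_def)
  also have "\<dots> \<noteq> 0"
  proof -
    have "emeasure lborel {0::real..1} \<le> emeasure lborel {0::real..}" by (intro emeasure_mono) auto
    then have "emeasure lborel {0::real..} \<noteq> 0" by auto
    then show ?thesis unfolding std_gaussian_def by (intro emeasure_normal_density_pos) auto
  qed
  finally show ?thesis .
qed

section \<open>The kernel: measurability, bounds and square integrability\<close>

lemma ar_kernel_measurable [measurable]:
  "case_prod (ar_kernel \<rho>) \<in> borel_measurable (borel \<Otimes>\<^sub>M borel)"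
  unfolding ar_kernel_def by measurable

lemma ar_kernel_sym: "ar_kernel \<rho> x y = ar_kernel \<rho> y x"
  by (simp add: ar_kernel_def algebra_simps)

lemma nn_integral_exp_square_finite:
  fixes \<delta> :: real
  assumes "\<delta> > 0"
  shows "(\<integral>\<^sup>+x. ennreal (exp (- \<delta> * x\<^sup>2)) \<partial>lborel) < \<infinity>"
proof -
  define \<sigma> where "\<sigma> = sqrt (1 / (2 * \<delta>))"
  have "\<sigma>\<^sup>2 = 1 / (2 * \<delta>)" using assms by (simp add: \<sigma>_def)
  then have "exp (- \<delta> * x\<^sup>2) = sqrt (pi / \<delta>) * normal_density 0 \<sigma> x" for x
    using assms by (simp add: normal_density_def)
  moreover have "\<sigma> > 0" using assms by (simp add: \<sigma>_def)
  ultimately have "integrable lborel (\<lambda>x. exp (- \<delta> * x\<^sup>2))" by simp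
  then show ?thesis by (simp add: integrable_iff_bounded)
qed

lemma ar_kernel_halfline_measurable [measurable]:
  "case_prod (ar_kernel \<rho>) \<in> borel_measurable (halfline_gaussian \<Otimes>\<^sub>M halfline_gaussian)"
  by measurable

text \<open>With values in \<open>ennreal\<close>, computations with the chain need no integrability
  conditions. On the half-line its iterates at 1 agree with the real ones, as the main proof
  shows.\<close>

definition ar_nn_operator :: "real \<Rightarrow> (real \<Rightarrow> ennreal) \<Rightarrow> real \<Rightarrow> ennreal" where
  "ar_nn_operator \<rho> f x = (\<integral>\<^sup>+y. f y * ennreal (ar_kernel \<rho> x y) \<partial>halfline_gaussian)"

lemma ar_nn_operator_measurable [measurable]:
  assumes [measurable]: "f \<in> borel_measurable borel"
  shows "ar_nn_operator \<rho> f \<in> borel_measurable borel"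
proof -
  interpret finite_measure halfline_gaussian by (rule finite_measure_halfline_gaussian)
  show ?thesis unfolding ar_nn_operator_def by measurable
qed

context
  fixes \<rho> :: real
  assumes \<rho>: "-1 < \<rho>" "\<rho> < 1"
begin

lemma one_minus_rho_square_pos: "0 < 1 - \<rho>\<^sup>2"
  using \<rho> abs_square_less_1[of \<rho>] by auto

lemma ar_kernel_pos: "0 < ar_kernel \<rho> x y"
  using one_minus_rho_square_pos by (simp add: ar_kernel_def)

text \<open>The negated numerator of the exponent equals
  \<open>(1 - \<rho>\<^sup>2) * x\<^sup>2 - (x - \<rho> * y)\<^sup>2\<close>. The bound is free of
  \<open>y\<close> and serves as \<open>B\<close>.\<close>

lemma ar_kernel_le: "ar_kernel \<rho> x y \<le> 1 / sqrt (1 - \<rho>\<^sup>2) * exp (x\<^sup>2 / 2)"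
proof -
  have "0 \<le> (x - \<rho> * y)\<^sup>2" by simp
  then have "- (\<rho>\<^sup>2 * x\<^sup>2 + \<rho>\<^sup>2 * y\<^sup>2 - 2 * \<rho> * x * y) \<le> (1 - \<rho>\<^sup>2) * x\<^sup>2"
    by (simp add: power2_eq_square algebra_simps)
  then have "- ((\<rho>\<^sup>2 * x\<^sup>2 + \<rho>\<^sup>2 * y\<^sup>2 - 2 * \<rho> * x * y) / (2 * (1 - \<rho>\<^sup>2))) \<le> x\<^sup>2 / 2"
    using one_minus_rho_square_pos unfolding minus_divide_left
    by (subst pos_divide_le_eq) (simp_all add: algebra_simps)
  then show ?thesis
    unfolding ar_kernel_def using one_minus_rho_square_pos by (intro mult_left_mono) auto
qed

text \<open>Completing the square in \<open>y\<close>. The kernel is thus the transition density,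
  relative to the Gaussian measure, of the rescaled chain.\<close>

lemma ar_kernel_std_normal_density:
  "ar_kernel \<rho> x y * std_normal_density y = normal_density (\<rho> * x) (sqrt (1 - \<rho>\<^sup>2)) y"
proof -
  define q where "q = 1 - \<rho>\<^sup>2"
  have q: "q > 0" "\<rho>\<^sup>2 = 1 - q" using one_minus_rho_square_pos by (auto simp: q_def)
  have "- (y - \<rho> * x)\<^sup>2 = - (\<rho>\<^sup>2 * x\<^sup>2 + \<rho>\<^sup>2 * y\<^sup>2 - 2 * \<rho> * x * y) - q * y\<^sup>2"
    by (simp add: power2_eq_square algebra_simps q_def)
  then have "- (y - \<rho> * x)\<^sup>2 / (2 * q)
      = - ((\<rho>\<^sup>2 * x\<^sup>2 + \<rho>\<^sup>2 * y\<^sup>2 - 2 * \<rho> * x * y) / (2 * q)) + - y\<^sup>2 / 2"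
    using q(1) by (simp add: diff_divide_distrib)
  then have "exp (- (y - \<rho> * x)\<^sup>2 / (2 * q))
      = exp (- ((\<rho>\<^sup>2 * x\<^sup>2 + \<rho>\<^sup>2 * y\<^sup>2 - 2 * \<rho> * x * y) / (2 * q))) * exp (- y\<^sup>2 / 2)"
    by (simp only: exp_add)
  then show ?thesis
    using q(1) unfolding ar_kernel_def normal_density_def q_def[symmetric]
    by (simp add: real_sqrt_mult mult_ac)
qed

text \<open>The left side is a constant times the exponential of a negated quadratic form in
  \<open>x\<close> and \<open>y\<close>. Its smallest eigenvalue is \<open>\<delta>\<close>,
  positive because the absolute value of \<open>\<rho>\<close> is below 1; the resulting bound
  separates the variables.\<close>

lemma ar_kernel_square_le:
  defines "\<delta> \<equiv> (1 - \<bar>\<rho>\<bar>) / (2 * (1 + \<bar>\<rho>\<bar>))"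
  shows "(ar_kernel \<rho> x y)\<^sup>2 * std_normal_density x * std_normal_density y
    \<le> 1 / (1 - \<rho>\<^sup>2) * exp (- \<delta> * x\<^sup>2) * exp (- \<delta> * y\<^sup>2)"
proof -
  define q where "q = 1 - \<rho>\<^sup>2"
  define E where "E = (\<rho>\<^sup>2 * x\<^sup>2 + \<rho>\<^sup>2 * y\<^sup>2 - 2 * \<rho> * x * y) / q"
  have q: "q > 0" using one_minus_rho_square_pos by (simp add: q_def)
  have \<delta>: "2 * q * \<delta> = (1 - \<bar>\<rho>\<bar>)\<^sup>2"
  proof -
    have "q = (1 - \<bar>\<rho>\<bar>) * (1 + \<bar>\<rho>\<bar>)" by (simp add: q_def power2_eq_square algebra_simps flip: abs_mult)
    moreover have "(1 + \<bar>\<rho>\<bar>) * \<delta> = (1 - \<bar>\<rho>\<bar>) / 2" by (simp add: \<delta>_def field_simps add_pos_nonneg[THEN less_imp_neq, symmetric])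
    ultimately show ?thesis by (simp add: power2_eq_square mult.assoc)
  qed
  have "2 * \<rho> * x * y \<le> \<bar>\<rho>\<bar> * (x\<^sup>2 + y\<^sup>2)"
  proof -
    have "2 * \<rho> * x * y \<le> \<bar>\<rho>\<bar> * (2 * \<bar>x\<bar> * \<bar>y\<bar>)"
      using abs_ge_self[of "2 * \<rho> * x * y"] by (simp add: abs_mult mult_ac)
    also have "\<dots> \<le> \<bar>\<rho>\<bar> * (x\<^sup>2 + y\<^sup>2)"
      using sum_squares_bound[of "\<bar>x\<bar>" "\<bar>y\<bar>"] by (intro mult_left_mono) auto
    finally show ?thesis .
  qed
  then have "- (2 * (\<rho>\<^sup>2 * x\<^sup>2 + \<rho>\<^sup>2 * y\<^sup>2 - 2 * \<rho> * x * y)) - q * (x\<^sup>2 + y\<^sup>2) \<le> - (2 * q * \<delta>) * (x\<^sup>2 + y\<^sup>2)"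
    unfolding \<delta> by (simp add: q_def power2_eq_square algebra_simps flip: abs_mult)
  then have "(- (2 * (\<rho>\<^sup>2 * x\<^sup>2 + \<rho>\<^sup>2 * y\<^sup>2 - 2 * \<rho> * x * y)) - q * (x\<^sup>2 + y\<^sup>2)) / (2 * q)
      \<le> - (2 * q * \<delta>) * (x\<^sup>2 + y\<^sup>2) / (2 * q)"
    using q by (intro divide_right_mono) auto
  also have "- (2 * q * \<delta>) * (x\<^sup>2 + y\<^sup>2) / (2 * q) = - \<delta> * x\<^sup>2 + - \<delta> * y\<^sup>2"
    using q by (simp add: field_simps)
  also have "(- (2 * (\<rho>\<^sup>2 * x\<^sup>2 + \<rho>\<^sup>2 * y\<^sup>2 - 2 * \<rho> * x * y)) - q * (x\<^sup>2 + y\<^sup>2)) / (2 * q)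
      = - E + - x\<^sup>2 / 2 + - y\<^sup>2 / 2"
  proof -
    have "(- (2 * P) - q * S) / (2 * q) = - (P / q) - S / 2" for P S
      using q by (simp add: field_simps)
    then show ?thesis unfolding E_def by (simp only: add_divide_distrib)
  qed
  finally have exponent: "- E + - x\<^sup>2 / 2 + - y\<^sup>2 / 2 \<le> - \<delta> * x\<^sup>2 + - \<delta> * y\<^sup>2" .
  have "(exp (- (P / (2 * q))))\<^sup>2 = exp (- (P / q))" for P
    by (simp flip: exp_double)
  then have "(ar_kernel \<rho> x y)\<^sup>2 = 1 / q * exp (- E)"
    using q unfolding ar_kernel_def q_def[symmetric] E_def
    by (simp only: power_mult_distrib power_divide real_sqrt_pow2 less_imp_le power_one)
  then have "(ar_kernel \<rho> x y)\<^sup>2 * std_normal_density x * std_normal_density y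
      = 1 / q * (1 / (2 * pi)) * exp (- E + - x\<^sup>2 / 2 + - y\<^sup>2 / 2)"
    unfolding std_normal_density_def exp_add by simp
  also have "\<dots> \<le> 1 / q * 1 * exp (- \<delta> * x\<^sup>2 + - \<delta> * y\<^sup>2)"
    using q exponent pi_ge_two by (intro mult_mono) auto
  finally show ?thesis unfolding q_def exp_add by (simp only: mult.assoc mult_1_left)
qed

lemma ar_kernel_square_integrable:
  "integrable halfline_gaussian (\<lambda>x. \<integral>y. (ar_kernel \<rho> x y)\<^sup>2 \<partial>halfline_gaussian)"
proof (rule integrableI_nonneg)
  interpret finite_measure halfline_gaussian by (rule finite_measure_halfline_gaussian)
  show "(\<lambda>x. \<integral>y. (ar_kernel \<rho> x y)\<^sup>2 \<partial>halfline_gaussian) \<in> borel_measurable halfline_gaussian"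
    by measurable
  define \<delta> where "\<delta> = (1 - \<bar>\<rho>\<bar>) / (2 * (1 + \<bar>\<rho>\<bar>))"
  have "\<delta> > 0" using \<rho> by (auto simp: \<delta>_def)
  define G where "G = (\<integral>\<^sup>+x. ennreal (exp (- \<delta> * x\<^sup>2)) \<partial>lborel)"
  define D where "D = ennreal (1 / (1 - \<rho>\<^sup>2))"
  have "G < \<infinity>" unfolding G_def by (rule nn_integral_exp_square_finite[OF \<open>\<delta> > 0\<close>])
  \<comment> \<open>An inequality suffices here: if the row is not integrable, the integral on the
    left has the default value 0.\<close>
  have "ennreal (\<integral>y. (ar_kernel \<rho> x y)\<^sup>2 \<partial>halfline_gaussian)
      \<le> (\<integral>\<^sup>+y. ennreal ((ar_kernel \<rho> x y)\<^sup>2) \<partial>halfline_gaussian)" for x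
  proof (cases "integrable halfline_gaussian (\<lambda>y. (ar_kernel \<rho> x y)\<^sup>2)")
    case True
    then show ?thesis by (subst nn_integral_eq_integral) auto
  qed (simp add: not_integrable_integral_eq)
  then have "(\<integral>\<^sup>+x. ennreal (\<integral>y. (ar_kernel \<rho> x y)\<^sup>2 \<partial>halfline_gaussian) \<partial>halfline_gaussian)
      \<le> (\<integral>\<^sup>+x. (\<integral>\<^sup>+y. ennreal ((ar_kernel \<rho> x y)\<^sup>2) \<partial>halfline_gaussian) \<partial>halfline_gaussian)"
    by (intro nn_integral_mono)
  also have "\<dots> = (\<integral>\<^sup>+x. (\<integral>\<^sup>+y. ennreal ((ar_kernel \<rho> x y)\<^sup>2) \<partial>halfline_gaussian)
      * indicator {0..} x * ennreal (std_normal_density x) \<partial>lborel)"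
    by (rule nn_integral_halfline_gaussian) measurable
  also have "\<dots> = (\<integral>\<^sup>+x. (\<integral>\<^sup>+y. ennreal ((ar_kernel \<rho> x y)\<^sup>2) * indicator {0..} y * ennreal (std_normal_density y)
      * (indicator {0..} x * ennreal (std_normal_density x)) \<partial>lborel) \<partial>lborel)"
    by (simp add: nn_integral_halfline_gaussian nn_integral_multc[symmetric] mult.assoc)
  also have "\<dots> \<le> (\<integral>\<^sup>+x. (\<integral>\<^sup>+y. D * ennreal (exp (- \<delta> * x\<^sup>2)) * ennreal (exp (- \<delta> * y\<^sup>2)) \<partial>lborel) \<partial>lborel)"
  proof (intro nn_integral_mono)
    fix x y :: real
    have "ennreal ((ar_kernel \<rho> x y)\<^sup>2) * indicator {0..} y * ennreal (std_normal_density y)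
        * (indicator {0..} x * ennreal (std_normal_density x))
      \<le> ennreal ((ar_kernel \<rho> x y)\<^sup>2 * std_normal_density x * std_normal_density y)"
      by (auto simp: indicator_def ennreal_mult mult_ac)
    also have "\<dots> \<le> ennreal (1 / (1 - \<rho>\<^sup>2) * exp (- \<delta> * x\<^sup>2) * exp (- \<delta> * y\<^sup>2))"
      using ar_kernel_square_le[of x y] unfolding \<delta>_def by (rule ennreal_leI)
    also have "\<dots> = D * ennreal (exp (- \<delta> * x\<^sup>2)) * ennreal (exp (- \<delta> * y\<^sup>2))"
      using one_minus_rho_square_pos by (simp add: D_def flip: ennreal_mult)
    finally show "ennreal ((ar_kernel \<rho> x y)\<^sup>2) * indicator {0..} y * ennreal (std_normal_density y)
        * (indicator {0..} x * ennreal (std_normal_density x))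
      \<le> D * ennreal (exp (- \<delta> * x\<^sup>2)) * ennreal (exp (- \<delta> * y\<^sup>2))" .
  qed
  also have "\<dots> = D * G * G"
    by (simp add: nn_integral_cmult nn_integral_multc mult.assoc G_def)
  also have "\<dots> < \<infinity>"
    using \<open>G < \<infinity>\<close> by (simp add: D_def ennreal_mult_less_top)
  finally show "(\<integral>\<^sup>+x. ennreal (\<integral>y. (ar_kernel \<rho> x y)\<^sup>2 \<partial>halfline_gaussian) \<partial>halfline_gaussian) < \<infinity>" .
qed auto

text \<open>The value is the probability that a normal variable with mean \<open>\<rho> * x\<close>
  is nonnegative, and the negative half-line has positive mass.\<close>

lemma ar_operator_one_less_1: "ar_operator \<rho> (\<lambda>_. 1) x < 1"
proof -
  define N where "N = density lborel (\<lambda>y. ennreal (normal_density (\<rho> * x) (sqrt (1 - \<rho>\<^sup>2)) y))"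
  interpret N: prob_space N
    unfolding N_def by (rule prob_space_normal_density) (use one_minus_rho_square_pos in simp)
  have [simp]: "sets N = sets borel" "space N = UNIV" by (auto simp: N_def)
  have *: "(\<integral>\<^sup>+y. ennreal (ar_kernel \<rho> x y) \<partial>halfline_gaussian) = emeasure N {0..}"
    unfolding N_def
    by (subst nn_integral_halfline_gaussian)
       (auto simp: emeasure_density ar_kernel_std_normal_density[symmetric] ennreal_mult
         less_imp_le[OF ar_kernel_pos] mult_ac intro!: nn_integral_cong)
  have "ar_operator \<rho> (\<lambda>_. 1) x = enn2real (emeasure N {0..})"
    unfolding ar_operator_def
    by (subst integral_eq_nn_integral) (auto simp: less_imp_le[OF ar_kernel_pos] *)
  also have "\<dots> = 1 - measure N {..<0}"
  proof -
    have "measure N {0..} = 1 - measure N {..<0}"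
      using N.prob_compl[of "{..<0}"] by (simp add: Compl_eq_Diff_UNIV[symmetric] Compl_lessThan)
    then show ?thesis by (simp add: measure_def)
  qed
  also have "\<dots> < 1"
  proof -
    have "emeasure lborel {-1<..<0::real} \<le> emeasure lborel {..<0::real}" by (intro emeasure_mono) auto
    then have "emeasure lborel {..<0::real} \<noteq> 0" by auto
    then have "emeasure N {..<0} \<noteq> 0"
      unfolding N_def using one_minus_rho_square_pos by (intro emeasure_normal_density_pos) auto
    then show ?thesis by (simp add: N.emeasure_eq_measure zero_less_measure_iff)
  qed
  finally show ?thesis .
qed

text \<open>Rescaling by \<open>sqrt (1 - \<rho>\<^sup>2)\<close> makes \<open>\<gamma>\<close> the stationary distribution.\<close>
lemma ar_nn_operator_transition:
  assumes [measurable]: "f \<in> borel_measurable borel"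
  defines "s \<equiv> sqrt (1 - \<rho>\<^sup>2)"
  shows "(\<integral>\<^sup>+z. ennreal (std_normal_density z) * (indicator {0..} (\<rho> * x + z) * f (s * (\<rho> * x + z))) \<partial>lborel)
    = ar_nn_operator \<rho> f (s * x)"
proof -
  have s: "s > 0" "s\<^sup>2 = 1 - \<rho>\<^sup>2" using one_minus_rho_square_pos by (auto simp: s_def)
  have density: "s * (ar_kernel \<rho> (s * x) (s * (\<rho> * x + z)) * std_normal_density (s * (\<rho> * x + z)))
      = std_normal_density z" for z
  proof -
    have "s * (\<rho> * x + z) - \<rho> * (s * x) = s * z" by (simp add: algebra_simps)
    then have "s * normal_density (\<rho> * (s * x)) s (s * (\<rho> * x + z)) = std_normal_density z"
      using s(1) unfolding normal_density_def by (simp add: real_sqrt_mult power_mult_distrib)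
    then show ?thesis
      unfolding ar_kernel_std_normal_density s_def .
  qed
  have "ar_nn_operator \<rho> f (s * x) = (\<integral>\<^sup>+y. f y * ennreal (ar_kernel \<rho> (s * x) y)
      * indicator {0..} y * ennreal (std_normal_density y) \<partial>lborel)"
    unfolding ar_nn_operator_def by (rule nn_integral_halfline_gaussian) measurable
  \<comment> \<open>Substitution \<open>y = s * (\<rho> * x + z)\<close>, the rescaled next position
    of the chain; its Jacobian \<open>s\<close> is the factor in \<open>density\<close>.\<close>
  also have "\<dots> = ennreal \<bar>s\<bar> * (\<integral>\<^sup>+z. f (s * \<rho> * x + s * z) * ennreal (ar_kernel \<rho> (s * x) (s * \<rho> * x + s * z))
      * indicator {0..} (s * \<rho> * x + s * z) * ennreal (std_normal_density (s * \<rho> * x + s * z)) \<partial>lborel)"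
    by (rule nn_integral_real_affine) (use s in auto)
  also have "\<dots> = (\<integral>\<^sup>+z. ennreal s * (f (s * \<rho> * x + s * z) * ennreal (ar_kernel \<rho> (s * x) (s * \<rho> * x + s * z))
      * indicator {0..} (s * \<rho> * x + s * z) * ennreal (std_normal_density (s * \<rho> * x + s * z))) \<partial>lborel)"
    using s(1) by (subst nn_integral_cmult) auto
  also have "\<dots> = (\<integral>\<^sup>+z. ennreal (std_normal_density z) * (indicator {0..} (\<rho> * x + z) * f (s * (\<rho> * x + z))) \<partial>lborel)"
  proof (intro nn_integral_cong)
    fix z
    have "s * \<rho> * x + s * z = s * (\<rho> * x + z)" by (simp add: algebra_simps)
    moreover have "indicator {0..} (s * (\<rho> * x + z)) = (indicator {0..} (\<rho> * x + z) :: ennreal)"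
      using s(1) by (simp add: indicator_def zero_le_mult_iff)
    moreover have "ennreal (std_normal_density z)
      = ennreal s * (ennreal (ar_kernel \<rho> (s * x) (s * (\<rho> * x + z))) * ennreal (std_normal_density (s * (\<rho> * x + z))))"
      using s(1) less_imp_le[OF ar_kernel_pos] by (subst density[symmetric]) (simp add: ennreal_mult)
    ultimately show "ennreal s * (f (s * \<rho> * x + s * z) * ennreal (ar_kernel \<rho> (s * x) (s * \<rho> * x + s * z))
      * indicator {0..} (s * \<rho> * x + s * z) * ennreal (std_normal_density (s * \<rho> * x + s * z)))
      = ennreal (std_normal_density z) * (indicator {0..} (\<rho> * x + z) * f (s * (\<rho> * x + z)))"
      by (simp add: mult_ac)
  qed
  finally show ?thesis ..
qed

end

section \<open>The autoregressive process\<close>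

text \<open>Independence makes the joint law a product measure, to which Tonelli applies.\<close>

lemma (in prob_space) indep_var_nn_integral:
  assumes ind: "indep_var S V T W" and [measurable]: "\<Phi> \<in> borel_measurable (S \<Otimes>\<^sub>M T)"
  shows "(\<integral>\<^sup>+\<omega>. \<Phi> (V \<omega>, W \<omega>) \<partial>M) = (\<integral>\<^sup>+\<omega>. (\<integral>\<^sup>+\<omega>'. \<Phi> (V \<omega>, W \<omega>') \<partial>M) \<partial>M)"
proof -
  have rv [measurable]: "random_variable S V" "random_variable T W"
    and eq: "distr M S V \<Otimes>\<^sub>M distr M T W = distr M (S \<Otimes>\<^sub>M T) (\<lambda>x. (V x, W x))"
    using ind unfolding indep_var_distribution_eq by auto
  interpret W: prob_space "distr M T W" by (rule prob_space_distr) measurable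
  have "(\<integral>\<^sup>+\<omega>. \<Phi> (V \<omega>, W \<omega>) \<partial>M) = (\<integral>\<^sup>+p. \<Phi> p \<partial>distr M (S \<Otimes>\<^sub>M T) (\<lambda>x. (V x, W x)))"
    by (subst nn_integral_distr) auto
  also have "\<dots> = (\<integral>\<^sup>+v. (\<integral>\<^sup>+t. \<Phi> (v, t) \<partial>distr M T W) \<partial>distr M S V)"
    unfolding eq[symmetric]
    by (subst W.nn_integral_fst[symmetric]) (auto cong: measurable_cong_sets sets_pair_measure_cong)
  also have "\<dots> = (\<integral>\<^sup>+v. (\<integral>\<^sup>+\<omega>'. \<Phi> (v, W \<omega>') \<partial>M) \<partial>distr M S V)"
    by (intro nn_integral_cong nn_integral_distr) auto
  also have "\<dots> = (\<integral>\<^sup>+\<omega>. (\<integral>\<^sup>+\<omega>'. \<Phi> (V \<omega>, W \<omega>') \<partial>M) \<partial>M)"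
    by (rule nn_integral_distr) measurable
  finally show ?thesis .
qed

text \<open>Writing the chain as a function of its innovations exhibits the past up to time
  \<open>N\<close> as a function of the innovations up to \<open>N\<close>, hence independent of the
  next one.\<close>

primrec ar_path :: "real \<Rightarrow> nat \<Rightarrow> (nat \<Rightarrow> real) \<Rightarrow> real" where
  "ar_path \<rho> 0 z = z 0"
| "ar_path \<rho> (Suc n) z = \<rho> * ar_path \<rho> n z + z (Suc n)"

lemma ar_path_restrict: "n \<le> N \<Longrightarrow> ar_path \<rho> n (restrict z {..N}) = ar_path \<rho> n z"
  by (induction n) auto

lemma ar_path_measurable:
  "n \<le> N \<Longrightarrow> ar_path \<rho> n \<in> borel_measurable (PiM {..N} (\<lambda>_. borel))"
proof (induction n)
  case 0
  then show ?case by (simp add: measurable_component_singleton)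
next
  case (Suc n)
  then have [measurable]: "ar_path \<rho> n \<in> borel_measurable (PiM {..N} (\<lambda>_. borel))"
    "(\<lambda>z. z (Suc n)) \<in> borel_measurable (PiM {..N} (\<lambda>_. borel :: real measure))"
    by (auto intro: measurable_component_singleton)
  show ?case by simp
qed

locale gaussian_autoregression = prob_space M for M :: "'a measure" +
  fixes \<rho> :: real and X \<xi> :: "nat \<Rightarrow> 'a \<Rightarrow> real"
  assumes \<rho>: "-1 < \<rho>" "\<rho> < 1"
    and indep: "indep_vars (\<lambda>_. borel) (\<lambda>n. if n = 0 then X 0 else \<xi> n) UNIV"
    and X_0: "distributed M lborel (X 0) std_normal_density"
    and \<xi>: "\<And>n. n \<ge> 1 \<Longrightarrow> distributed M lborel (\<xi> n) std_normal_density"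
    and X_step: "\<And>n \<omega>. n \<ge> 1 \<Longrightarrow> \<omega> \<in> space M \<Longrightarrow> X n \<omega> = \<rho> * X (n - 1) \<omega> + \<xi> n \<omega>"
begin

definition Z :: "nat \<Rightarrow> 'a \<Rightarrow> real" where
  "Z n = (if n = 0 then X 0 else \<xi> n)"

definition stay :: "nat \<Rightarrow> 'a set" where
  "stay N = {\<omega> \<in> space M. \<forall>n\<le>N. 0 \<le> X n \<omega>}"

abbreviation s :: real where
  "s \<equiv> sqrt (1 - \<rho>\<^sup>2)"

lemma X_Suc: "\<omega> \<in> space M \<Longrightarrow> X (Suc n) \<omega> = \<rho> * X n \<omega> + Z (Suc n) \<omega>"
  using X_step[of "Suc n"] by (simp add: Z_def)

lemma Z_distributed: "distributed M lborel (Z n) std_normal_density"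
  using X_0 \<xi>[of n] by (simp add: Z_def)

lemma Z_measurable [measurable]: "Z n \<in> borel_measurable M"
  using distributed_measurable[OF Z_distributed[of n]] by simp

lemma X_eq_ar_path: "\<omega> \<in> space M \<Longrightarrow> X n \<omega> = ar_path \<rho> n (\<lambda>i. Z i \<omega>)"
  by (induction n) (auto simp: X_Suc Z_def[of 0])

lemma X_measurable [measurable]: "X n \<in> borel_measurable M"
proof (induction n)
  case 0
  then show ?case using Z_measurable[of 0] by (simp add: Z_def)
next
  case (Suc n)
  then have [measurable]: "X n \<in> borel_measurable M" .
  have "(\<lambda>\<omega>. \<rho> * X n \<omega> + Z (Suc n) \<omega>) \<in> borel_measurable M" by measurable
  then show ?case by (simp add: X_Suc cong: measurable_cong)
qed

lemma stay_measurable [measurable]: "stay N \<in> sets M"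
  unfolding stay_def by measurable

lemma indep_Z: "indep_vars (\<lambda>_. borel) Z UNIV"
  using indep by (simp add: Z_def[abs_def])

text \<open>The event \<open>stay N\<close> and the position \<open>X N\<close> depend on
  \<open>V\<close> only, the new innovation is \<open>W\<close>. Integrating out \<open>W\<close>
  first with \<open>V\<close> frozen amounts to one application of the operator.\<close>

lemma markov_step:
  assumes [measurable]: "f \<in> borel_measurable borel"
  shows "(\<integral>\<^sup>+\<omega>. indicator (stay (Suc N)) \<omega> * f (s * X (Suc N) \<omega>) \<partial>M)
    = (\<integral>\<^sup>+\<omega>. indicator (stay N) \<omega> * ar_nn_operator \<rho> f (s * X N \<omega>) \<partial>M)"
proof -
  define V W where "V \<omega> = restrict (\<lambda>i. Z i \<omega>) {..N}" and "W \<omega> = restrict (\<lambda>i. Z i \<omega>) {Suc N}" for \<omega>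
  let ?S = "PiM {..N} (\<lambda>_. borel :: real measure)" and ?T = "PiM {Suc N} (\<lambda>_. borel :: real measure)"
  define \<Phi> :: "(nat \<Rightarrow> real) \<times> (nat \<Rightarrow> real) \<Rightarrow> ennreal" where
    "\<Phi> p = of_bool (\<forall>n\<in>{..N}. 0 \<le> ar_path \<rho> n (fst p))
      * (indicator {0..} (\<rho> * ar_path \<rho> N (fst p) + snd p (Suc N))
        * f (s * (\<rho> * ar_path \<rho> N (fst p) + snd p (Suc N))))" for p
  have ind: "indep_var ?S V ?T W"
    unfolding V_def W_def by (rule indep_var_restrict[OF indep_Z]) auto
  have [measurable]: "(\<lambda>z. z (Suc N)) \<in> borel_measurable ?T"
    by (rule measurable_component_singleton) simp
  have [measurable]: "ar_path \<rho> n \<in> borel_measurable ?S" if "n \<in> {..N}" for n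
    using that by (auto intro: ar_path_measurable)
  have N[measurable]: "ar_path \<rho> N \<in> borel_measurable ?S" by (auto intro: ar_path_measurable)
  have \<Phi>: "\<Phi> \<in> borel_measurable (?S \<Otimes>\<^sub>M ?T)"
    unfolding \<Phi>_def by measurable
  have path: "ar_path \<rho> n (V \<omega>) = X n \<omega>" if "n \<le> N" "\<omega> \<in> space M" for n \<omega>
    using that by (simp add: V_def ar_path_restrict X_eq_ar_path)
  have stay_V: "of_bool (\<forall>n\<in>{..N}. 0 \<le> ar_path \<rho> n (V \<omega>)) = (indicator (stay N) \<omega> :: ennreal)"
    if "\<omega> \<in> space M" for \<omega>
    using that path by (auto simp: stay_def indicator_def)
  have "(\<integral>\<^sup>+\<omega>. indicator (stay (Suc N)) \<omega> * f (s * X (Suc N) \<omega>) \<partial>M) = (\<integral>\<^sup>+\<omega>. \<Phi> (V \<omega>, W \<omega>) \<partial>M)"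
  proof (intro nn_integral_cong)
    fix \<omega> assume \<omega>: "\<omega> \<in> space M"
    have "indicator (stay (Suc N)) \<omega> = (indicator (stay N) \<omega> * indicator {0..} (X (Suc N) \<omega>) :: ennreal)"
      using \<omega> by (auto simp: stay_def indicator_def le_Suc_eq)
    then show "indicator (stay (Suc N)) \<omega> * f (s * X (Suc N) \<omega>) = \<Phi> (V \<omega>, W \<omega>)"
      using \<omega> unfolding \<Phi>_def fst_conv snd_conv stay_V[OF \<omega>]
      by (simp add: path X_Suc W_def mult.assoc)
  qed
  also have "\<dots> = (\<integral>\<^sup>+\<omega>. (\<integral>\<^sup>+\<omega>'. \<Phi> (V \<omega>, W \<omega>') \<partial>M) \<partial>M)"
    by (rule indep_var_nn_integral[OF ind \<Phi>])
  also have "\<dots> = (\<integral>\<^sup>+\<omega>. indicator (stay N) \<omega> * ar_nn_operator \<rho> f (s * X N \<omega>) \<partial>M)"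
  proof (intro nn_integral_cong)
    fix \<omega> assume \<omega>: "\<omega> \<in> space M"
    have "(\<integral>\<^sup>+\<omega>'. \<Phi> (V \<omega>, W \<omega>') \<partial>M) = (\<integral>\<^sup>+\<omega>'. indicator (stay N) \<omega>
        * (indicator {0..} (\<rho> * X N \<omega> + Z (Suc N) \<omega>') * f (s * (\<rho> * X N \<omega> + Z (Suc N) \<omega>'))) \<partial>M)"
      using \<omega> unfolding \<Phi>_def fst_conv snd_conv stay_V[OF \<omega>] by (simp add: path W_def)
    also have "\<dots> = indicator (stay N) \<omega> * (\<integral>\<^sup>+z. ennreal (std_normal_density z)
        * (indicator {0..} (\<rho> * X N \<omega> + z) * f (s * (\<rho> * X N \<omega> + z))) \<partial>lborel)"
      by (subst distributed_nn_integral[OF Z_distributed[of "Suc N"]]) (auto intro!: nn_integral_cmult)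
    also have "\<dots> = indicator (stay N) \<omega> * ar_nn_operator \<rho> f (s * X N \<omega>)"
      by (subst ar_nn_operator_transition[OF \<rho>]) auto
    finally show "(\<integral>\<^sup>+\<omega>'. \<Phi> (V \<omega>, W \<omega>') \<partial>M) = indicator (stay N) \<omega> * ar_nn_operator \<rho> f (s * X N \<omega>)" .
  qed
  finally show ?thesis .
qed

text \<open>Induction on \<open>N\<close> for all \<open>f\<close> at once: the last step of the
  chain is absorbed into the test function.\<close>

lemma nn_integral_stay:
  assumes "f \<in> borel_measurable borel"
  shows "(\<integral>\<^sup>+\<omega>. indicator (stay N) \<omega> * f (s * X N \<omega>) \<partial>M) = (ar_nn_operator \<rho> ^^ Suc N) f 0"
  using assms
proof (induction N arbitrary: f)
  case 0
  note [measurable] = 0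
  have "(\<integral>\<^sup>+\<omega>. indicator (stay 0) \<omega> * f (s * X 0 \<omega>) \<partial>M) = (\<integral>\<^sup>+\<omega>. indicator {0..} (X 0 \<omega>) * f (s * X 0 \<omega>) \<partial>M)"
    by (intro nn_integral_cong) (auto simp: stay_def indicator_def)
  also have "\<dots> = (\<integral>\<^sup>+z. ennreal (std_normal_density z) * (indicator {0..} z * f (s * z)) \<partial>lborel)"
    by (subst distributed_nn_integral[OF X_0, symmetric]) auto
  \<comment> \<open>The standard normal \<open>X 0\<close> counts as a step from position 0, which
    explains \<open>Suc N\<close> applications for \<open>N\<close> transitions.\<close>
  also have "\<dots> = ar_nn_operator \<rho> f 0"
    using ar_nn_operator_transition[OF \<rho> 0, of 0] by simp
  finally show ?case by simp
next
  case (Suc N)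
  then show ?case
    using markov_step[OF Suc.prems, of N] Suc.IH[of "ar_nn_operator \<rho> f"]
    by (simp add: funpow_swap1)
qed

lemma emeasure_stay: "emeasure M (stay N) = (ar_nn_operator \<rho> ^^ Suc N) (\<lambda>_. 1) 0"
  using nn_integral_stay[of "\<lambda>_. 1" N] by simp

end

section \<open>Application of the operator theory to the chain\<close>

lemma positive_kernel_halfline_gaussian:
  assumes "-1 < \<rho>" "\<rho> < 1"
  shows "positive_kernel halfline_gaussian (ar_kernel \<rho>) (\<lambda>x. 1 / sqrt (1 - \<rho>\<^sup>2) * exp (x\<^sup>2 / 2))"
proof (intro positive_kernel.intro positive_kernel_axioms.intro)
  show "emeasure halfline_gaussian (space halfline_gaussian) \<noteq> 0"
    using emeasure_halfline_gaussian_space by simp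
  show "(\<lambda>x. 1 / sqrt (1 - \<rho>\<^sup>2) * exp (x\<^sup>2 / 2)) \<in> borel_measurable halfline_gaussian"
    by measurable
qed (use ar_kernel_pos[OF assms] ar_kernel_le[OF assms] ar_kernel_sym ar_kernel_square_integrable[OF assms]
    ar_kernel_halfline_measurable finite_measure_halfline_gaussian in auto)

theorem theorem1:
  fixes \<rho> :: real
    and M :: "'a measure"
    and X \<xi> :: "nat \<Rightarrow> 'a \<Rightarrow> real"
  assumes "-1 < \<rho>" and "\<rho> < 1"
    and "prob_space M"
    and "prob_space.indep_vars M (\<lambda>_. borel) (\<lambda>n. if n = 0 then X 0 else \<xi> n) UNIV"
    and "distributed M lborel (X 0) std_normal_density"
    and "\<And>n. n \<ge> 1 \<Longrightarrow> distributed M lborel (\<xi> n) std_normal_density"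
    and "\<And>n \<omega>. n \<ge> 1 \<Longrightarrow> \<omega> \<in> space M \<Longrightarrow> X n \<omega> = \<rho> * X (n - 1) \<omega> + \<xi> n \<omega>"
  shows "\<exists>lam. L2_largest_eigenvalue halfline_gaussian (ar_operator \<rho>) lam \<and>
           lam \<in> {0<..<1} \<and>
           (\<exists>c>0. \<exists>C>0. \<forall>N::nat.
              c * lam ^ N \<le> measure M {\<omega> \<in> space M. \<forall>n\<le>N. 0 \<le> X n \<omega>} \<and>
              measure M {\<omega> \<in> space M. \<forall>n\<le>N. 0 \<le> X n \<omega>} \<le> C * lam ^ N)"
proof -
  interpret ar: gaussian_autoregression M \<rho> X \<xi>
    using assms by (intro gaussian_autoregression.intro gaussian_autoregression_axioms.intro)
  interpret kernel: positive_kernel halfline_gaussian "ar_kernel \<rho>" "\<lambda>x. 1 / sqrt (1 - \<rho>\<^sup>2) * exp (x\<^sup>2 / 2)"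
    using assms(1,2) by (rule positive_kernel_halfline_gaussian)
  have T: "kernel.T = ar_operator \<rho>"
    by (intro ext) (simp add: kernel.T_def ar_operator_def)
  have nn_power: "(ar_nn_operator \<rho> ^^ n) (\<lambda>_. 1) x = ennreal (kernel.u n x)" if "0 \<le> x" for n x
    using that
  proof (induction n arbitrary: x)
    case (Suc n)
    have "(ar_nn_operator \<rho> ^^ Suc n) (\<lambda>_. 1) x
      = (\<integral>\<^sup>+y. ennreal (kernel.u n y * ar_kernel \<rho> x y) \<partial>halfline_gaussian)"
      unfolding funpow.simps o_def ar_nn_operator_def[of \<rho> "(ar_nn_operator \<rho> ^^ n) (\<lambda>_. 1)"]
      by (intro nn_integral_cong) (simp add: Suc.IH ennreal_mult kernel.u_pos kernel.k_pos less_imp_le)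
    also have "\<dots> = ennreal (kernel.u (Suc n) x)"
      unfolding kernel.u_Suc kernel.T_def using Suc.prems
      by (intro nn_integral_eq_integral kernel.T_integrable kernel.u_L2 AE_I2)
         (auto intro!: mult_pos_pos less_imp_le kernel.u_pos kernel.k_pos)
    finally show ?case .
  qed simp
  have stay: "measure M {\<omega> \<in> space M. \<forall>n\<le>N. 0 \<le> X n \<omega>} = kernel.u (Suc N) 0" for N
    using ar.emeasure_stay[of N] kernel.u_pos[of 0 "Suc N"]
    by (simp add: nn_power ar.stay_def measure_def del: funpow.simps)
  have lam: "0 < kernel.lam" "kernel.lam < 1"
    using kernel.lam_pos kernel.lam_less_1 ar_operator_one_less_1[OF assms(1,2)] unfolding T by auto
  obtain c C where cC: "c > 0" "C > 0"
    "\<And>n. c * kernel.lam ^ n \<le> kernel.u n 0" "\<And>n. kernel.u n 0 \<le> C * kernel.lam ^ n"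
    using kernel.u_asymp[of 0] by auto
  show ?thesis
  proof (rule exI[of _ kernel.lam], intro conjI)
    show "L2_largest_eigenvalue halfline_gaussian (ar_operator \<rho>) kernel.lam"
      using kernel.lam_largest_eigenvalue unfolding T .
    show "kernel.lam \<in> {0<..<1}" using lam by simp
    \<comment> \<open>The probability is the iterate of index \<open>Suc N\<close>, so one factor
      \<open>lam\<close> moves into each constant.\<close>
    have "c * kernel.lam * kernel.lam ^ N \<le> kernel.u (Suc N) 0"
      "kernel.u (Suc N) 0 \<le> C * kernel.lam * kernel.lam ^ N" for N
      using cC(3,4)[of "Suc N"] by (simp_all add: mult_ac)
    then show "\<exists>c>0. \<exists>C>0. \<forall>N::nat.
              c * kernel.lam ^ N \<le> measure M {\<omega> \<in> space M. \<forall>n\<le>N. 0 \<le> X n \<omega>} \<and>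
              measure M {\<omega> \<in> space M. \<forall>n\<le>N. 0 \<le> X n \<omega>} \<le> C * kernel.lam ^ N"
      unfolding stay using cC(1,2) lam(1)
      by (intro exI[of _ "c * kernel.lam"] exI[of _ "C * kernel.lam"] conjI allI) auto
  qed
qed

end
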